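(* Let $K\in\mathbb{N}=\{1,2,\dots\}$. The random variable $Z_K$ has a smooth Lebesgue density which, together with all its derivatives, is rapidly decreasing, i.e., decreases faster than any polynomial.
   Context: Let $p_1<\dots<p_K$ be the order statistics of $K$ independent random variables uniformly distributed on $[0,1]$, and define the spacings $D_0=p_1$, $D_i=p_{i+1}-p_i$ for $1\le i\le K-1$, $D_K=1-p_K$, $D=(D_0,\dots,D_K)$. Let $\mathcal{T}$ be the (finite) set of all binary search trees with internal nodes $p_1,\dots,p_K$ and external nodes (leaves) $S_0,\dots,S_K$ from left to right (i.e. all full binary trees with $K$ internal nodes and $K+1$ leaves). For $t\in\mathcal{T}$ let $h_t(i)$ be the depth of the leaf $S_i$ in $t$ (the root having depth $0$), and $l_t(x_0,\dots,x_K)=\sum_{i=0}^K x_i h_t(i)$. Put $l_{\mathrm{opt}}(D)=\min_{t\in\mathcal{T}}l_t(D)$, $\gamma_K=\mathbb{E}[l_{\mathrm{opt}}(D)]$, and $\alpha_K=\gamma_K/(H_{K+1}-1)$, where $H_n=\sum_{i=1}^n\frac1i$. $Z_K$ denotes a random variable whose distribution is the unique centered, square integrable probability measure on $\mathbb{R}$ such that $$Z_K\stackrel{d}{=}\sum_{i=0}^K\left(D_iZ_K^{(i)}+\alpha_KD_i\ln(D_i)\right)+l_{\mathrm{opt}}(D),$$ where $D,Z_K^{(0)},\dots,Z_K^{(K)}$ are independent and each $Z_K^{(i)}$ has the same distribution as $Z_K$. (It is the limit in distribution of the normalized number of key comparisons of optimal $K$-pivot QuickSort.) *)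

theory Defs
  imports "HOL-Probability.Probability" "HOL-Library.Tree"
begin

section \<open>Spacings of uniform random variables\<close>

definition order_stat :: "nat \<Rightarrow> (nat \<Rightarrow> real) \<Rightarrow> nat \<Rightarrow> real" where
  "order_stat K u i = sort (map u [1..<Suc K]) ! (i - 1)"

text \<open>Only the indices \<open>i = 0, \<dots>, K\<close> are meaningful, and \<open>K \<ge> 1\<close> is intended.\<close>

definition spacing :: "nat \<Rightarrow> (nat \<Rightarrow> real) \<Rightarrow> nat \<Rightarrow> real" where
  "spacing K u i =
     (if i = 0 then order_stat K u 1
      else if i < K then order_stat K u (i + 1) - order_stat K u i
      else 1 - order_stat K u K)"

definition uniforms :: "nat \<Rightarrow> (nat \<Rightarrow> real) measure" where
  "uniforms K = (\<Pi>\<^sub>M i\<in>{1..K}. uniform_measure lborel {0..1})"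

section \<open>Optimal binary search trees\<close>

text \<open>The key \<open>j\<close> stands for the \<open>j\<close>-th smallest pivot; the \<open>Leaf\<close> nodes are the external nodes.\<close>

definition search_trees :: "nat \<Rightarrow> nat tree set" where
  "search_trees K = {t. bst t \<and> set_tree t = {1..K}}"

text \<open>The depths of the external nodes, listed from left to right.\<close>

fun leaf_depths :: "'a tree \<Rightarrow> nat list" where
  "leaf_depths Leaf = [0]"
| "leaf_depths (Node l a r) = map Suc (leaf_depths l @ leaf_depths r)"

definition tree_cost :: "nat \<Rightarrow> nat tree \<Rightarrow> (nat \<Rightarrow> real) \<Rightarrow> real" where
  "tree_cost K t x = (\<Sum>i=0..K. x i * real (leaf_depths t ! i))"

definition l_opt :: "nat \<Rightarrow> (nat \<Rightarrow> real) \<Rightarrow> real" where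
  "l_opt K x = Min ((\<lambda>t. tree_cost K t x) ` search_trees K)"

text \<open>The minimum is over a finite nonempty set, and every tree has exactly \<open>K + 1\<close> leaves.\<close>

lemma length_leaf_depths: "length (leaf_depths t) = size t + 1"
  by (induction t) auto

lemma distinct_inorder_bst: "bst (t :: 'a :: linorder tree) \<Longrightarrow> distinct (inorder t)"
  by (induction t) fastforce+

lemma size_search_trees:
  assumes "t \<in> search_trees K"
  shows "size t = K"
proof -
  have "size t = card (set (inorder t))"
    using assms distinct_card[OF distinct_inorder_bst, of t]
    by (simp add: search_trees_def)
  with assms show ?thesis by (simp add: search_trees_def)
qed

lemma finite_trees_bounded:
  assumes "finite A"
  shows "finite {t. size t \<le> n \<and> set_tree t \<subseteq> A}"
proof (induction n)
  case 0
  have "{t :: 'a tree. size t \<le> 0 \<and> set_tree t \<subseteq> A} \<subseteq> {Leaf}" by auto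
  then show ?case by (rule finite_subset) simp
next
  case (Suc n)
  let ?T = "{t. size t \<le> n \<and> set_tree t \<subseteq> A}"
  have "{t. size t \<le> Suc n \<and> set_tree t \<subseteq> A}
          \<subseteq> insert Leaf ((\<lambda>(l, a, r). Node l a r) ` (?T \<times> A \<times> ?T))"
  proof
    fix t assume "t \<in> {t. size t \<le> Suc n \<and> set_tree t \<subseteq> A}"
    then show "t \<in> insert Leaf ((\<lambda>(l, a, r). Node l a r) ` (?T \<times> A \<times> ?T))"
      by (cases t) (auto simp: image_iff)
  qed
  moreover have "finite (insert Leaf ((\<lambda>(l, a, r). Node l a r) ` (?T \<times> A \<times> ?T)))"
    using Suc assms by simp
  ultimately show ?case by (rule finite_subset)
qed

lemma finite_search_trees: "finite (search_trees K)"
proof (rule finite_subset)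
  show "search_trees K \<subseteq> {t. size t \<le> K \<and> set_tree t \<subseteq> {1..K}}"
    using size_search_trees by (auto simp: search_trees_def)
qed (simp add: finite_trees_bounded)

lemma search_trees_nonempty: "search_trees K \<noteq> {}"
proof (induction K)
  case 0
  have "Leaf \<in> search_trees 0" by (simp add: search_trees_def)
  then show ?case by blast
next
  case (Suc K)
  then obtain t where "t \<in> search_trees K" by blast
  then have "Node t (Suc K) Leaf \<in> search_trees (Suc K)"
    by (auto simp: search_trees_def)
  then show ?case by blast
qed

section \<open>The limit law\<close>

definition \<gamma> :: "nat \<Rightarrow> real" where
  "\<gamma> K = (\<integral>u. l_opt K (spacing K u) \<partial>uniforms K)"

definition \<alpha> :: "nat \<Rightarrow> real" where
  "\<alpha> K = \<gamma> K / (harm (K + 1) - 1)"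

text \<open>
  The law of the right-hand side of the distributional recursion if the copies have law \<open>\<mu>\<close>.
  The coordinates \<open>z 0, \<dots>, z K\<close> and \<open>u\<close> of a point of the product space are the independent
  random variables. As \<open>ln 0 = 0\<close>, the summands \<open>D ln D\<close> take their continuous value at \<open>D = 0\<close>.
\<close>

definition recursion_law :: "nat \<Rightarrow> real measure \<Rightarrow> real measure" where
  "recursion_law K \<mu> =
     distr ((\<Pi>\<^sub>M i\<in>{0..K}. \<mu>) \<Otimes>\<^sub>M uniforms K) borel
       (\<lambda>(z, u).
          (\<Sum>i=0..K. spacing K u i * z i + \<alpha> K * spacing K u i * ln (spacing K u i))
            + l_opt K (spacing K u))"

text \<open>Integrability of the identity, needed for the mean to be meaningful, follows from
  square integrability because \<open>\<mu>\<close> is a probability measure.\<close>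

definition quicksort_limit_law :: "nat \<Rightarrow> real measure \<Rightarrow> bool" where
  "quicksort_limit_law K \<mu> \<longleftrightarrow>
     real_distribution \<mu> \<and>
     integrable \<mu> (\<lambda>x. x\<^sup>2) \<and>
     (\<integral>x. x \<partial>\<mu>) = 0 \<and>
     \<mu> = recursion_law K \<mu>"

section \<open>Smoothness and rapid decrease\<close>

definition smooth :: "(real \<Rightarrow> real) \<Rightarrow> bool" where
  "smooth f \<longleftrightarrow> (\<forall>k x. (deriv ^^ k) f differentiable (at x))"

definition rapidly_decreasing :: "(real \<Rightarrow> real) \<Rightarrow> bool" where
  "rapidly_decreasing f \<longleftrightarrow> (\<forall>n. ((\<lambda>x. \<bar>x\<bar> ^ n * \<bar>f x\<bar>) \<longlongrightarrow> 0) at_infinity)"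

end

theory Submission
  imports Defs
begin

text \<open>
  Write \<open>\<phi>\<close> for the characteristic function of the limit law and \<open>D\<close> for the spacings. Conditionally on the
  copies and on all pivots but one, the right-hand side of the recursion is, as a function of the
  remaining pivot and up to a bounded number of exceptional points, an affine function plus
  \<open>\<alpha> \<Sum> D\<^sub>i ln D\<^sub>i\<close>, whose second derivative is at least \<open>\<alpha> > 0\<close>. Van der Corput's lemma
  then gives \<open>\<phi> t = O(t powr (- 1 / 2))\<close>. Since \<open>\<bar>\<phi> t\<bar>\<close> is at most the expectation of
  \<open>\<Prod> \<bar>\<phi> (t D\<^sub>i)\<bar>\<close>, and at least two spacings are rarely small, each application of the recursion gains
  a factor \<open>t powr (- 1 / 3)\<close>, so \<open>\<phi>\<close> decays faster than any power and Fourier inversion yields a smooth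
  density with bounded derivatives. The recursion also bootstraps the tail bound coming from the second
  moment to arbitrary polynomial order: a large value needs two large copies, or one large copy multiplied by a
  spacing, and \<open>\<Sum> D\<^sub>i\<^sup>q\<close> has expectation less than \<open>1\<close> for \<open>q \<ge> 2\<close>. Finally, a function with small increments
  and bounded second derivative has a small derivative, which transfers the decay from the tails to the
  density and all its derivatives.
\<close>

section \<open>Oscillatory integrals\<close>

text \<open>The obstacle to convexity in one pivot is \<open>l_opt\<close>: as a minimum of linear
  costs it is concave, and its kinks work against the convex entropy term. Between kinks and changes
  of rank it is affine, so the unit interval is cut there. The number of pieces is bounded in terms
  of \<open>K\<close> alone and the copies enter the phase only through affine terms, whence a bound
  uniform in the copies and in the other pivots. In the product bound the largest spacing merely
  reproduces the known exponent; the gain comes from a second spacing. The threshold t powr (- 1 /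
  3) balances, for the starting exponent 1 / 2, the probability that this spacing is small against
  the factor (t powr (2 / 3)) powr (- 1 / 2). The tail bootstrap starts where the contraction
  starts: for q = 1 the spacings sum to 1 and nothing is gained, while the second moment supplies q
  = 2. Decay of the density is not read off from derivatives of \<phi>: it is interpolated between
  the decay of the increments of the distribution function and the boundedness of the derivatives of
  the density.\<close>

lemma integral_bound_length:
  fixes F :: "real \<Rightarrow> real"
  assumes "c \<le> d" "F integrable_on {c..d}" "\<And>x. \<bar>F x\<bar> \<le> 1"
  shows "\<bar>integral {c..d} F\<bar> \<le> d - c"
proof -
  have "norm (integral {c..d} F) \<le> integral {c..d} (\<lambda>_. 1::real)"
    using assms by (intro integral_norm_bound_integral) auto
  also have "\<dots> = d - c" using assms by simp
  finally show ?thesis by simp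
qed

lemma integral_split_real:
  fixes F :: "real \<Rightarrow> real"
  assumes "a \<le> c" "c \<le> b" "F integrable_on {a..b}"
  shows "integral {a..b} F = integral {a..c} F + integral {c..b} F"
  using Henstock_Kurzweil_Integration.integral_combine[OF assms] by simp

text \<open>Near \<open>m\<close> the trivial bound is used; further right \<open>\<psi>'\<close> is
  at least sqrt lam and cos \<psi> is the monotone weight 1 / \<psi>' times the derivative of sin
  \<psi>. The constant is 1 for the initial piece plus 2 for each of two boundary terms. Growth is
  demanded of \<open>\<psi>'\<close> itself, so no second derivative appears.\<close>

lemma van_der_Corput_right:
  fixes \<psi> \<psi>' :: "real \<Rightarrow> real"
  assumes "m \<le> b" and lam: "lam > 0"
    and der: "\<And>x. m \<le> x \<Longrightarrow> x \<le> b \<Longrightarrow> (\<psi> has_real_derivative \<psi>' x) (at x)"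
    and grow: "\<And>x y. m \<le> x \<Longrightarrow> x \<le> y \<Longrightarrow> y \<le> b \<Longrightarrow> lam * (y - x) \<le> \<psi>' y - \<psi>' x"
    and "\<psi>' m \<ge> 0"
  shows "\<bar>integral {m..b} (\<lambda>x. cos (\<psi> x))\<bar> \<le> 5 / sqrt lam"
proof -
  \<comment> \<open>This length balances the trivial bound \<eta> against the oscillation bound 1 /
    (lam * \<eta>).\<close>
  define \<eta> where "\<eta> = 1 / sqrt lam"
  have \<eta>: "\<eta> > 0" "lam * \<eta> = sqrt lam"
    using lam by (auto simp: \<eta>_def field_simps)
  have cont: "continuous_on {m..b} (\<lambda>x. cos (\<psi> x))"
    by (intro continuous_on_cos continuous_at_imp_continuous_on ballI DERIV_isCont[OF der]) auto
  have int: "(\<lambda>x. cos (\<psi> x)) integrable_on {c..d}" if "m \<le> c" "d \<le> b" for c d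
    by (rule integrable_continuous_interval, rule continuous_on_subset[OF cont]) (use that in auto)
  show ?thesis
  proof (cases "b \<le> m + \<eta>")
    case True
    have "\<bar>integral {m..b} (\<lambda>x. cos (\<psi> x))\<bar> \<le> b - m"
      using \<open>m \<le> b\<close> int by (intro integral_bound_length) auto
    also have "\<dots> \<le> 5 * \<eta>" using True \<eta> by linarith
    finally show ?thesis by (simp add: \<eta>_def)
  next
    case False
    define c where "c = m + \<eta>"
    have c: "m \<le> c" "c \<le> b" using False \<eta> by (auto simp: c_def)
    have pos: "\<psi>' x \<ge> sqrt lam" if "c \<le> x" "x \<le> b" for x
    proof -
      have "lam * \<eta> \<le> lam * (x - m)" using that lam by (intro mult_left_mono) (auto simp: c_def)
      also have "\<dots> \<le> \<psi>' x - \<psi>' m" using grow[of m x] that c by auto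
      finally show ?thesis using \<eta> \<open>\<psi>' m \<ge> 0\<close> by linarith
    qed
    have sl: "sqrt lam > 0" using lam by simp
    have FTC: "((\<lambda>x. \<psi>' x * cos (\<psi> x)) has_integral (sin (\<psi> q) - sin (\<psi> p))) {p..q}"
      if "c \<le> p" "p \<le> q" "q \<le> b" for p q
    proof (rule fundamental_theorem_of_calculus)
      fix x assume "x \<in> {p..q}"
      then have "((\<lambda>x. sin (\<psi> x)) has_real_derivative \<psi>' x * cos (\<psi> x)) (at x)"
        using that c by (auto intro!: derivative_eq_intros der)
      then show "((\<lambda>x. sin (\<psi> x)) has_vector_derivative \<psi>' x * cos (\<psi> x)) (at x within {p..q})"
        by (simp add: has_real_derivative_iff_has_vector_derivative has_vector_derivative_at_within)
    qed (use that in auto)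
    \<comment> \<open>Second mean value theorem; the weight is negated because it has to be
      nondecreasing.\<close>
    obtain e where e: "e \<in> {c..b}" and
      "integral {c..b} (\<lambda>x. (- inverse (\<psi>' x)) * (\<psi>' x * cos (\<psi> x))) =
         (- inverse (\<psi>' c)) * integral {c..e} (\<lambda>x. \<psi>' x * cos (\<psi> x)) +
         (- inverse (\<psi>' b)) * integral {e..b} (\<lambda>x. \<psi>' x * cos (\<psi> x))"
    proof (rule second_mean_value_theorem[of "\<lambda>x. \<psi>' x * cos (\<psi> x)" c b "\<lambda>x. - inverse (\<psi>' x)"])
      show "(\<lambda>x. \<psi>' x * cos (\<psi> x)) integrable_on {c..b}"
        using FTC[of c b] c by (auto simp: integrable_on_def)
      fix x y assume xy: "c \<le> x" "x \<le> y" "y \<le> b"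
      have "\<psi>' x \<le> \<psi>' y"
        using grow[of x y] xy c lam mult_nonneg_nonneg[of lam "y - x"] by linarith
      moreover have "\<psi>' x > 0" using pos[of x] xy sl by linarith
      ultimately show "- inverse (\<psi>' x) \<le> - inverse (\<psi>' y)" by (simp add: le_imp_inverse_le)
    qed (use c in auto)
    moreover have "integral {c..b} (\<lambda>x. (- inverse (\<psi>' x)) * (\<psi>' x * cos (\<psi> x)))
        = integral {c..b} (\<lambda>x. - cos (\<psi> x))"
    proof (rule Henstock_Kurzweil_Integration.integral_cong)
      fix x assume "x \<in> {c..b}"
      then have "\<psi>' x \<noteq> 0" using pos[of x] sl by force
      then show "(- inverse (\<psi>' x)) * (\<psi>' x * cos (\<psi> x)) = - cos (\<psi> x)" by simp
    qed
    moreover have "integral {c..e} (\<lambda>x. \<psi>' x * cos (\<psi> x)) = sin (\<psi> e) - sin (\<psi> c)"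
      "integral {e..b} (\<lambda>x. \<psi>' x * cos (\<psi> x)) = sin (\<psi> b) - sin (\<psi> e)"
      using FTC[of c e] FTC[of e b] e by auto
    ultimately have eq: "integral {c..b} (\<lambda>x. cos (\<psi> x)) =
        inverse (\<psi>' c) * (sin (\<psi> e) - sin (\<psi> c)) + inverse (\<psi>' b) * (sin (\<psi> b) - sin (\<psi> e))"
      by simp
    have inv: "\<bar>inverse (\<psi>' x)\<bar> \<le> \<eta>" if "c \<le> x" "x \<le> b" for x
    proof -
      have "\<psi>' x > 0" using pos[OF that] sl by linarith
      then show ?thesis using le_imp_inverse_le[OF pos[OF that] sl]
        by (simp add: \<eta>_def inverse_eq_divide[symmetric])
    qed
    have sin2: "\<bar>sin x - sin y\<bar> \<le> 2" for x y :: real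
      using abs_sin_le_one[of x] abs_sin_le_one[of y] by linarith
    have "\<bar>inverse (\<psi>' c) * (sin (\<psi> e) - sin (\<psi> c))\<bar> \<le> \<eta> * 2"
      "\<bar>inverse (\<psi>' b) * (sin (\<psi> b) - sin (\<psi> e))\<bar> \<le> \<eta> * 2"
      unfolding abs_mult using c \<eta> inv sin2 by (auto intro!: mult_mono simp del: abs_inverse)
    then have "\<bar>integral {c..b} (\<lambda>x. cos (\<psi> x))\<bar> \<le> 4 * \<eta>"
      unfolding eq by linarith
    moreover have "\<bar>integral {m..c} (\<lambda>x. cos (\<psi> x))\<bar> \<le> c - m"
      using c int by (intro integral_bound_length) auto
    moreover have "integral {m..b} (\<lambda>x. cos (\<psi> x)) =
        integral {m..c} (\<lambda>x. cos (\<psi> x)) + integral {c..b} (\<lambda>x. cos (\<psi> x))"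
      using c int by (intro integral_split_real) auto
    ultimately have "\<bar>integral {m..b} (\<lambda>x. cos (\<psi> x))\<bar> \<le> 5 * \<eta>"
      unfolding c_def by linarith
    then show ?thesis by (simp add: \<eta>_def)
  qed
qed

lemma van_der_Corput_left:
  fixes \<psi> \<psi>' :: "real \<Rightarrow> real"
  assumes "a \<le> m" and lam: "lam > 0"
    and der: "\<And>x. a \<le> x \<Longrightarrow> x \<le> m \<Longrightarrow> (\<psi> has_real_derivative \<psi>' x) (at x)"
    and grow: "\<And>x y. a \<le> x \<Longrightarrow> x \<le> y \<Longrightarrow> y \<le> m \<Longrightarrow> lam * (y - x) \<le> \<psi>' y - \<psi>' x"
    and "\<psi>' m \<le> 0"
  shows "\<bar>integral {a..m} (\<lambda>x. cos (\<psi> x))\<bar> \<le> 5 / sqrt lam"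
proof -
  have "\<bar>integral {-m..-a} (\<lambda>x. cos (\<psi> (- x)))\<bar> \<le> 5 / sqrt lam"
  proof (rule van_der_Corput_right[where \<psi>' = "\<lambda>x. - \<psi>' (- x)"])
    fix x assume "- m \<le> x" "x \<le> - a"
    then have "(\<psi> has_real_derivative \<psi>' (- x)) (at (- x))" by (intro der) auto
    then have "(\<psi> \<circ> uminus has_real_derivative \<psi>' (- x) * - 1) (at x)"
      by (rule DERIV_chain) (auto intro!: derivative_eq_intros)
    then show "((\<lambda>x. \<psi> (- x)) has_real_derivative - \<psi>' (- x)) (at x)"
      by (simp add: o_def)
  next
    fix x y assume "- m \<le> x" "x \<le> y" "y \<le> - a"
    then show "lam * (y - x) \<le> - \<psi>' (- y) - - \<psi>' (- x)" using grow[of "-y" "-x"] by simp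
  qed (use assms in auto)
  then show ?thesis using Henstock_Kurzweil_Integration.integral_reflect_real[of m a "\<lambda>x. cos (\<psi> x)"] by simp
qed

text \<open>Since \<open>\<psi>'\<close> is strictly increasing, it either keeps its sign or has one
  zero, at which the interval is split into two one-sided cases.\<close>

lemma van_der_Corput:
  fixes \<psi> \<psi>' :: "real \<Rightarrow> real"
  assumes "a \<le> b" and lam: "lam > 0"
    and der: "\<And>x. a \<le> x \<Longrightarrow> x \<le> b \<Longrightarrow> (\<psi> has_real_derivative \<psi>' x) (at x)"
    and cont: "continuous_on {a..b} \<psi>'"
    and grow: "\<And>x y. a \<le> x \<Longrightarrow> x \<le> y \<Longrightarrow> y \<le> b \<Longrightarrow> lam * (y - x) \<le> \<psi>' y - \<psi>' x"
  shows "\<bar>integral {a..b} (\<lambda>x. cos (\<psi> x))\<bar> \<le> 10 / sqrt lam"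
proof -
  have sl: "5 / sqrt lam \<le> 10 / sqrt lam" using lam by (intro divide_right_mono) auto
  consider "\<psi>' a \<ge> 0" | "\<psi>' b \<le> 0" | "\<psi>' a < 0" "\<psi>' b > 0" by linarith
  then show ?thesis
  proof cases
    case 1 then show ?thesis using van_der_Corput_right[of a b lam \<psi> \<psi>'] assms sl by force
  next
    case 2 then show ?thesis using van_der_Corput_left[of a b lam \<psi> \<psi>'] assms sl by force
  next
    case 3
    then obtain m where m: "a \<le> m" "m \<le> b" "\<psi>' m = 0"
      using IVT'[of \<psi>' a 0 b] assms by auto
    have "continuous_on {a..b} (\<lambda>x. cos (\<psi> x))"
      by (intro continuous_on_cos continuous_at_imp_continuous_on ballI DERIV_isCont[OF der]) auto
    then have "integral {a..b} (\<lambda>x. cos (\<psi> x)) =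
        integral {a..m} (\<lambda>x. cos (\<psi> x)) + integral {m..b} (\<lambda>x. cos (\<psi> x))"
      using m by (intro integral_split_real integrable_continuous_interval) auto
    moreover have "\<bar>integral {a..m} (\<lambda>x. cos (\<psi> x))\<bar> \<le> 5 / sqrt lam"
      using m by (intro van_der_Corput_left[of a m lam \<psi> \<psi>'] assms) auto
    moreover have "\<bar>integral {m..b} (\<lambda>x. cos (\<psi> x))\<bar> \<le> 5 / sqrt lam"
      using m by (intro van_der_Corput_right[of m b lam \<psi> \<psi>'] assms) auto
    ultimately show ?thesis by simp
  qed
qed

text \<open>The derivative of x * ln x is infinite at 0, so the phase can be controlled only on
  compact subintervals of an open piece. Shaving off two short ends costs arbitrarily
  little.\<close>

lemma integral_bound_open_interval:
  fixes F :: "real \<Rightarrow> real"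
  assumes "c < d" and int: "\<And>p q. F integrable_on {p..q}" and F1: "\<And>x. \<bar>F x\<bar> \<le> 1"
    and B: "\<And>p q. c < p \<Longrightarrow> p \<le> q \<Longrightarrow> q < d \<Longrightarrow> \<bar>integral {p..q} F\<bar> \<le> B"
  shows "\<bar>integral {c..d} F\<bar> \<le> B"
proof (rule field_le_epsilon)
  fix e :: real assume "e > 0"
  define h where "h = min (e / 2) ((d - c) / 2)"
  have h: "h > 0" "h \<le> e / 2" "h \<le> (d - c) / 2" unfolding h_def using \<open>e > 0\<close> \<open>c < d\<close> by (simp_all only: min.cobounded1 min.cobounded2) simp
  then have cd: "c + h \<le> d - h" by (auto simp: field_simps)
  have "integral {c..d} F = integral {c..c+h} F + integral {c+h..d} F"
    using h cd int by (intro integral_split_real) auto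
  moreover have "integral {c+h..d} F = integral {c+h..d-h} F + integral {d-h..d} F"
    using h cd int by (intro integral_split_real) auto
  moreover have "\<bar>integral {c..c+h} F\<bar> \<le> h" "\<bar>integral {d-h..d} F\<bar> \<le> h"
    using integral_bound_length[of c "c+h" F] integral_bound_length[of "d-h" d F] h int F1 by auto
  moreover have "\<bar>integral {c+h..d-h} F\<bar> \<le> B" using B h cd by auto
  ultimately show "\<bar>integral {c..d} F\<bar> \<le> B + e" using h by linarith
qed

text \<open>Induction on the number of exceptional points inside the interval, splitting at any one
  of them.\<close>

lemma integral_bound_finite_exceptions:
  fixes F :: "real \<Rightarrow> real"
  assumes "finite P" and int: "\<And>p q. F integrable_on {p..q}"
    and B: "\<And>c d. a \<le> c \<Longrightarrow> c < d \<Longrightarrow> d \<le> b \<Longrightarrow> {c<..<d} \<inter> P = {} \<Longrightarrow> \<bar>integral {c..d} F\<bar> \<le> B"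
    and "a < b"
  shows "\<bar>integral {a..b} F\<bar> \<le> (real (card P) + 1) * B"
proof -
  have B0: "B \<ge> 0" if "c < d" "a \<le> c" "d \<le> b" "{c<..<d} \<inter> P = {}" for c d using B that by force
  have *: "a \<le> c \<Longrightarrow> c < d \<Longrightarrow> d \<le> b \<Longrightarrow> card (P \<inter> {c<..<d}) = n \<Longrightarrow>
      \<bar>integral {c..d} F\<bar> \<le> (real n + 1) * B" for n c d
  proof (induction n arbitrary: c d rule: less_induct)
    case (less n)
    show ?case
    proof (cases "P \<inter> {c<..<d} = {}")
      case True
      then show ?thesis using B[of c d] less.prems by (auto simp: Int_commute)
    next
      case False
      then obtain p where p: "p \<in> P" "c < p" "p < d" by auto
      have eq: "P \<inter> {c<..<d} = insert p ((P \<inter> {c<..<p}) \<union> (P \<inter> {p<..<d}))" using p by auto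
      have "card ((P \<inter> {c<..<p}) \<union> (P \<inter> {p<..<d})) = card (P \<inter> {c<..<p}) + card (P \<inter> {p<..<d})"
        using \<open>finite P\<close> by (intro card_Un_disjoint) auto
      then have n: "n = card (P \<inter> {c<..<p}) + card (P \<inter> {p<..<d}) + 1"
        using \<open>finite P\<close> less.prems(4) unfolding eq by (subst (asm) card_insert_disjoint) auto
      have "\<bar>integral {c..p} F\<bar> \<le> (real (card (P \<inter> {c<..<p})) + 1) * B"
        using p n less.prems by (intro less.IH) auto
      moreover have "\<bar>integral {p..d} F\<bar> \<le> (real (card (P \<inter> {p<..<d})) + 1) * B"
        using p n less.prems by (intro less.IH) auto
      moreover have "integral {c..d} F = integral {c..p} F + integral {p..d} F"
        using p int by (intro integral_split_real) auto
      moreover have "(real n + 1) * B =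
          (real (card (P \<inter> {c<..<p})) + 1) * B + (real (card (P \<inter> {p<..<d})) + 1) * B"
        by (simp add: n algebra_simps)
      ultimately show ?thesis by linarith
    qed
  qed
  \<comment> \<open>Passing from the points inside the interval to all of \<open>P\<close> needs a
    nonnegative \<open>B\<close>. Its sign is read off from one gap, between \<open>a\<close> and
    the next exceptional point or \<open>b\<close>.\<close>
  have "B \<ge> 0"
  proof -
    have "\<exists>c d. a \<le> c \<and> c < d \<and> d \<le> b \<and> {c<..<d} \<inter> P = {}"
    proof -
      define d where "d = Min (insert b {p \<in> P. a < p})"
      have "d \<in> insert b {p \<in> P. a < p}" unfolding d_def using \<open>finite P\<close> by (intro Min_in) auto
      moreover have "d \<le> b" unfolding d_def using \<open>finite P\<close> by (intro Min_le) auto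
      moreover have "d \<le> p" if "p \<in> P" "a < p" for p
        unfolding d_def using \<open>finite P\<close> that by (intro Min_le) auto
      ultimately show ?thesis using \<open>a < b\<close> by (intro exI[of _ a] exI[of _ d]) force
    qed
    then show ?thesis using B0 by blast
  qed
  have "\<bar>integral {a..b} F\<bar> \<le> (real (card (P \<inter> {a<..<b})) + 1) * B"
    using * \<open>a < b\<close> by auto
  also have "\<dots> \<le> (real (card P) + 1) * B"
    using \<open>finite P\<close> \<open>B \<ge> 0\<close> by (intro mult_right_mono) (auto intro: card_mono)
  finally show ?thesis .
qed

section \<open>Spacings\<close>

text \<open>Padding by the endpoints 0 and 1 turns the three cases of \<open>spacing\<close> into
  one difference of neighbours.\<close>

definition bounded_order_stats :: "nat \<Rightarrow> (nat \<Rightarrow> real) \<Rightarrow> real list" where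
  "bounded_order_stats K u = 0 # sort (map u [1..<Suc K]) @ [1]"

lemma length_bounded_order_stats [simp]: "length (bounded_order_stats K u) = K + 2"
  by (simp add: bounded_order_stats_def)

lemma spacing_eq_diff:
  assumes "K \<ge> 1" "i \<le> K"
  shows "spacing K u i = bounded_order_stats K u ! Suc i - bounded_order_stats K u ! i"
proof -
  have len: "length (sort (map u [1..<Suc K])) = K" by simp
  show ?thesis
    using assms len
    by (auto simp del: upt_Suc length_sort
        simp add: spacing_def order_stat_def bounded_order_stats_def nth_append nth_Cons')
qed

text \<open>The product space contains all real values of the coordinates; pointwise bounds on
  spacings hold on this set, which has full measure.\<close>

definition unit_points :: "nat \<Rightarrow> (nat \<Rightarrow> real) set" where
  "unit_points K = {u. \<forall>i\<in>{1..K}. u i \<in> {0..1}}"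

lemma sorted_bounded_order_stats:
  assumes "u \<in> unit_points K"
  shows "sorted (bounded_order_stats K u)"
  using assms by (fastforce simp: bounded_order_stats_def sorted_append unit_points_def simp del: upt_Suc)

lemma spacing_nonneg:
  assumes "K \<ge> 1" "u \<in> unit_points K" "i \<le> K"
  shows "0 \<le> spacing K u i"
  using sorted_nth_mono[OF sorted_bounded_order_stats[OF assms(2)], of i "Suc i"] assms
  by (simp add: spacing_eq_diff)

lemma sum_spacing:
  assumes "K \<ge> 1"
  shows "(\<Sum>i=0..K. spacing K u i) = 1"
proof -
  have "(\<Sum>i=0..K. spacing K u i)
      = (\<Sum>i=0..K. bounded_order_stats K u ! Suc i - bounded_order_stats K u ! i)"
    using assms by (intro sum.cong) (auto simp: spacing_eq_diff)
  also have "\<dots> = bounded_order_stats K u ! Suc K - bounded_order_stats K u ! 0"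
    by (rule sum_Suc_diff) simp
  also have "\<dots> = 1"
    by (simp add: bounded_order_stats_def nth_append del: upt_Suc)
  finally show ?thesis .
qed

lemma spacing_le_1:
  assumes "K \<ge> 1" "u \<in> unit_points K" "i \<le> K"
  shows "spacing K u i \<le> 1"
proof -
  have "spacing K u i \<le> (\<Sum>i=0..K. spacing K u i)"
    using assms by (intro member_le_sum spacing_nonneg) auto
  then show ?thesis using sum_spacing assms by simp
qed

lemma first_spacing_ge:
  assumes "K \<ge> 1" "\<And>i. i \<in> {1..K} \<Longrightarrow> e \<le> u i"
  shows "e \<le> spacing K u 0"
proof -
  have "sort (map u [1..<Suc K]) ! 0 \<in> set (sort (map u [1..<Suc K]))"
    using assms(1) by (intro nth_mem) simp
  then have "sort (map u [1..<Suc K]) ! 0 \<in> u ` {1..K}"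
    by (auto simp del: upt_Suc)
  then show ?thesis using assms(2) by (auto simp: spacing_def order_stat_def simp del: upt_Suc)
qed

lemma last_spacing_ge:
  assumes "K \<ge> 1" "\<And>i. i \<in> {1..K} \<Longrightarrow> u i \<le> 1 - e"
  shows "e \<le> spacing K u K"
proof -
  have "sort (map u [1..<Suc K]) ! (K - 1) \<in> set (sort (map u [1..<Suc K]))"
    using assms(1) by (intro nth_mem) simp
  then have "sort (map u [1..<Suc K]) ! (K - 1) \<in> u ` {1..K}"
    by (auto simp del: upt_Suc)
  then show ?thesis using assms by (fastforce simp: spacing_def order_stat_def simp del: upt_Suc)
qed

lemma large_spacing_exists:
  assumes "K \<ge> 1"
  shows "\<exists>i\<le>K. 1 / (real K + 1) \<le> spacing K u i"
proof (rule ccontr)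
  assume "\<not> ?thesis"
  then have "(\<Sum>i=0..K. spacing K u i) < (\<Sum>i=0..K. 1 / (real K + 1))"
    by (intro sum_strict_mono) auto
  then show False using sum_spacing[OF assms, of u] by (simp add: field_simps)
qed

section \<open>Level sets of order statistics by counting\<close>

lemma sorted_nth_le_iff:
  fixes xs :: "'a :: linorder list"
  assumes "sorted xs" "j < length xs"
  shows "xs ! j \<le> c \<longleftrightarrow> j < length (filter (\<lambda>x. x \<le> c) xs)"
  using assms
proof (induction xs arbitrary: j)
  case (Cons x xs)
  show ?case
  proof (cases "x \<le> c")
    case True
    then show ?thesis using Cons by (cases j) auto
  next
    case False
    then have "filter (\<lambda>x. x \<le> c) xs = []" using Cons.prems(1) by (auto simp: filter_empty_conv)
    moreover have "\<not> (x # xs) ! j \<le> c"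
      using sorted_nth_mono[OF Cons.prems(1), of 0 j] Cons.prems(2) False by auto
    ultimately show ?thesis using False by simp
  qed
qed simp

lemma length_filter_map_upt:
  "real (length (filter P (map u [1..<Suc K]))) = (\<Sum>k\<in>{1..K}. if P (u k) then 1 else 0)"
proof (induction K)
  case (Suc K)
  have "{1..Suc K} = insert (Suc K) {1..K}" by auto
  with Suc show ?case by simp
qed simp

text \<open>Counting the points up to \<open>c\<close> replaces sorting by a sum of indicators of
  the coordinates, from which measurability follows.\<close>

lemma order_stat_le_iff:
  assumes "1 \<le> i" "i \<le> K"
  shows "order_stat K u i \<le> c \<longleftrightarrow> real i \<le> (\<Sum>k\<in>{1..K}. if u k \<le> c then 1 else 0)"
proof -
  have "order_stat K u i \<le> c \<longleftrightarrow>
      i - 1 < length (filter (\<lambda>x. x \<le> c) (sort (map u [1..<Suc K])))"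
    unfolding order_stat_def using assms by (intro sorted_nth_le_iff) auto
  also have "\<dots> \<longleftrightarrow> i \<le> length (filter (\<lambda>x. x \<le> c) (map u [1..<Suc K]))"
    using assms by (auto simp: filter_sort simp del: upt_Suc)
  also have "\<dots> \<longleftrightarrow> real i \<le> (\<Sum>k\<in>{1..K}. if u k \<le> c then 1 else 0)"
    by (simp only: of_nat_le_iff[symmetric, where 'a = real] length_filter_map_upt)
  finally show ?thesis .
qed

section \<open>The law of the pivots and of the spacings\<close>

lemma prob_space_unit: "prob_space (uniform_measure lborel {0..1::real})"
  by (rule prob_space_uniform_measure) auto

interpretation uniform_unit: prob_space "uniform_measure lborel {0..1::real}"
  by (rule prob_space_unit)

lemma prob_space_uniforms: "prob_space (uniforms K)"
  unfolding uniforms_def by (intro prob_space_PiM prob_space_unit)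

lemma measurable_coord_uniforms:
  "i \<in> {1..K} \<Longrightarrow> (\<lambda>u. u i) \<in> borel_measurable (uniforms K)"
  unfolding uniforms_def
  using measurable_component_singleton[of i "{1..K}" "\<lambda>_. uniform_measure lborel {0..1::real}"]
  by simp

lemma measurable_order_stat:
  assumes "1 \<le> i" "i \<le> K"
  shows "(\<lambda>u. order_stat K u i) \<in> borel_measurable (uniforms K)"
proof (rule borel_measurableI_le)
  fix c :: real
  have [measurable]: "(\<lambda>u. \<Sum>k\<in>{1..K}. if u k \<le> c then 1 else 0 :: real) \<in> borel_measurable (uniforms K)"
    using measurable_coord_uniforms by (intro borel_measurable_sum) measurable
  show "{u \<in> space (uniforms K). order_stat K u i \<le> c} \<in> sets (uniforms K)"
    unfolding order_stat_le_iff[OF assms] by measurable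
qed

lemma measurable_spacing [measurable]:
  assumes "K \<ge> 1"
  shows "(\<lambda>u. spacing K u i) \<in> borel_measurable (uniforms K)"
proof -
  have [measurable]: "(\<lambda>u. order_stat K u j) \<in> borel_measurable (uniforms K)"
    if "1 \<le> j" "j \<le> K" for j using that by (rule measurable_order_stat)
  show ?thesis
    unfolding spacing_def using assms measurable_order_stat[of 1 K] measurable_order_stat[of "i+1" K]
      measurable_order_stat[of i K] measurable_order_stat[of K K]
    by (cases "i = 0"; cases "i < K") auto
qed

lemma AE_coord_uniforms:
  assumes "i \<in> {1..K}" "AE x in uniform_measure lborel {0..1}. P x"
  shows "AE u in uniforms K. P (u i)"
  unfolding uniforms_def
  by (rule AE_PiM_component[OF _ assms(1)]) (use assms prob_space_unit in auto)

lemma AE_unit_points: "AE u in uniforms K. u \<in> unit_points K"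
proof -
  have "AE x in uniform_measure lborel {0..1}. x \<in> {0..1::real}"
    by (rule AE_uniform_measureI) auto
  then have "AE u in uniforms K. \<forall>i\<in>{1..K}. u i \<in> {0..1}"
    by (intro AE_finite_allI AE_coord_uniforms) auto
  then show ?thesis by (simp add: unit_points_def)
qed

lemma prob_coord_uniforms:
  assumes "i \<in> {1..K}" "A \<in> sets borel"
  shows "measure (uniforms K) {u \<in> space (uniforms K). u i \<in> A} = measure lborel ({0..1} \<inter> A)"
proof -
  have "emeasure (uniform_measure lborel {0..1}) A =
      emeasure (distr (uniforms K) (uniform_measure lborel {0..1}) (\<lambda>u. u i)) A"
    unfolding uniforms_def using assms prob_space_unit by (subst distr_PiM_component) auto
  also have "\<dots> = emeasure (uniforms K) {u \<in> space (uniforms K). u i \<in> A}"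
    using assms measurable_coord_uniforms[OF assms(1)]
    by (subst emeasure_distr) (auto simp: vimage_def Int_def conj_commute)
  finally have "emeasure (uniforms K) {u \<in> space (uniforms K). u i \<in> A} =
      emeasure (uniform_measure lborel {0..1}) A" ..
  also have "\<dots> = emeasure lborel ({0..1} \<inter> A)" using assms by (subst emeasure_uniform_measure) (auto simp: divide_ennreal_def)
  finally show ?thesis by (simp add: measure_def)
qed

text \<open>A small outer spacing forces some pivot within \<open>e\<close> of 0 or 1. The union
  bound over the pivots thus avoids the law of the order statistics.\<close>

lemma prob_small_first_or_last_spacing:
  assumes "K \<ge> 1" "0 \<le> e"
  shows "measure (uniforms K) {u \<in> space (uniforms K). spacing K u 0 < e \<or> spacing K u K < e} \<le> 2 * real K * e"
proof -
  interpret U: prob_space "uniforms K" by (rule prob_space_uniforms)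
  let ?A = "{..<e} \<union> {1-e<..}"
  have "{u \<in> space (uniforms K). spacing K u 0 < e \<or> spacing K u K < e}
      \<subseteq> (\<Union>i\<in>{1..K}. {u \<in> space (uniforms K). u i \<in> ?A})"
  proof clarsimp
    fix u assume "spacing K u 0 < e \<or> spacing K u K < e"
    then show "\<exists>i\<in>{Suc 0..K}. u i < e \<or> 1 - e < u i"
      using first_spacing_ge[OF assms(1), of e u] last_spacing_ge[OF assms(1), of u e] by force
  qed
  then have "measure (uniforms K) {u \<in> space (uniforms K). spacing K u 0 < e \<or> spacing K u K < e}
      \<le> measure (uniforms K) (\<Union>i\<in>{1..K}. {u \<in> space (uniforms K). u i \<in> ?A})"
    using measurable_coord_uniforms by (intro U.finite_measure_mono) auto
  also have "\<dots> \<le> (\<Sum>i\<in>{1..K}. measure (uniforms K) {u \<in> space (uniforms K). u i \<in> ?A})"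
    using measurable_coord_uniforms by (intro U.finite_measure_subadditive_finite) auto
  also have "\<dots> \<le> (\<Sum>i\<in>{1..K}. 2 * e)"
  proof (rule sum_mono)
    fix i assume i: "i \<in> {1..K}"
    have "measure lborel ({0..1} \<inter> ?A) \<le> measure lborel ({0..e} \<union> {1-e..1})"
      using fmeasurableI[of "{0..e}" lborel] fmeasurableI[of "{1-e..1}" lborel]
      by (intro measure_mono_fmeasurable) (auto simp: emeasure_lborel_Icc_eq)
    also have "\<dots> \<le> measure lborel {0..e} + measure lborel {1-e..1}"
      by (rule measure_Un_le) auto
    also have "\<dots> = 2 * e" using assms by simp
    finally show "measure (uniforms K) {u \<in> space (uniforms K). u i \<in> ?A} \<le> 2 * e"
      using i by (subst prob_coord_uniforms) auto
  qed
  finally show ?thesis by (simp add: algebra_simps)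
qed

section \<open>The toll function\<close>

lemma leaf_depth_le_size: "i \<le> size t \<Longrightarrow> leaf_depths t ! i \<le> size t"
proof (induction t arbitrary: i)
  case (Node l a r)
  show ?case
  proof (cases "i \<le> size l")
    case True
    then show ?thesis using Node.IH(1)[of i] by (simp add: nth_append length_leaf_depths)
  next
    case False
    then have "i - Suc (size l) \<le> size r" using Node.prems by simp
    from Node.IH(2)[OF this] show ?thesis using False Node.prems
      by (simp add: nth_append length_leaf_depths)
  qed
qed simp

lemma leaf_depth_ge_1: "i \<le> size t \<Longrightarrow> 1 \<le> size t \<Longrightarrow> 1 \<le> leaf_depths t ! i"
  by (cases t) (auto simp: length_leaf_depths simp del: map_append)

definition toll :: "nat \<Rightarrow> (nat \<Rightarrow> real) \<Rightarrow> real" where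
  "toll K u = (\<Sum>i=0..K. \<alpha> K * spacing K u i * ln (spacing K u i)) + l_opt K (spacing K u)"

context
  fixes K :: nat
  assumes K: "K \<ge> 1"
begin

text \<open>For K \<ge> 1 the root is an internal node, so every leaf has depth at least 1. The
  positivity of \<gamma> and \<alpha> originates here.\<close>

lemma l_opt_spacing_ge_1:
  assumes "u \<in> unit_points K"
  shows "1 \<le> l_opt K (spacing K u)"
  unfolding l_opt_def
proof (rule Min.boundedI)
  fix c assume "c \<in> (\<lambda>t. tree_cost K t (spacing K u)) ` search_trees K"
  then obtain t where t: "t \<in> search_trees K" "c = tree_cost K t (spacing K u)" by blast
  have "(\<Sum>i=0..K. spacing K u i * 1) \<le> (\<Sum>i=0..K. spacing K u i * real (leaf_depths t ! i))"
    using K leaf_depth_ge_1 size_search_trees[OF t(1)] spacing_nonneg[OF K assms]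
    by (intro sum_mono mult_left_mono) fastforce+
  then show "1 \<le> c" using t sum_spacing[OF K] by (simp add: tree_cost_def)
qed (use finite_search_trees search_trees_nonempty in auto)

lemma l_opt_spacing_le:
  assumes "u \<in> unit_points K"
  shows "l_opt K (spacing K u) \<le> real K"
proof -
  obtain t where t: "t \<in> search_trees K" using search_trees_nonempty by blast
  have "l_opt K (spacing K u) \<le> tree_cost K t (spacing K u)"
    unfolding l_opt_def using t finite_search_trees by (intro Min_le) auto
  also have "\<dots> \<le> (\<Sum>i=0..K. spacing K u i * real K)"
    unfolding tree_cost_def
    using leaf_depth_le_size size_search_trees[OF t(1)] spacing_nonneg[OF K assms]
    by (intro sum_mono mult_left_mono) fastforce+
  also have "\<dots> = K" using sum_spacing[OF K] by (simp add: sum_distrib_right[symmetric])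
  finally show ?thesis .
qed

lemma measurable_l_opt_spacing [measurable]:
  "(\<lambda>u. l_opt K (spacing K u)) \<in> borel_measurable (uniforms K)"
  unfolding l_opt_def tree_cost_def using K
  by (intro borel_measurable_Min finite_search_trees) measurable

lemma \<gamma>_ge_1: "1 \<le> \<gamma> K"
proof -
  interpret U: prob_space "uniforms K" by (rule prob_space_uniforms)
  have "(\<integral>u. 1 \<partial>uniforms K) \<le> \<gamma> K"
    unfolding \<gamma>_def
  proof (rule integral_mono_AE)
    show "integrable (uniforms K) (\<lambda>u. l_opt K (spacing K u))"
    proof (rule U.integrable_const_bound[where B = K])
      show "AE u in uniforms K. norm (l_opt K (spacing K u)) \<le> real K"
        using AE_unit_points by eventually_elim (use l_opt_spacing_le l_opt_spacing_ge_1 in force)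
    qed measurable
    show "AE u in uniforms K. 1 \<le> l_opt K (spacing K u)"
      using AE_unit_points by eventually_elim (rule l_opt_spacing_ge_1)
  qed simp
  then show ?thesis by (simp add: U.prob_space)
qed

text \<open>This sign makes the entropy term of the toll convex in each pivot and supplies the
  constant in the oscillation estimate.\<close>

lemma \<alpha>_pos: "0 < \<alpha> K"
proof -
  have "harm 2 \<le> (harm (K + 1) :: real)" using K by (intro harm_mono) auto
  then have "harm (K + 1) - 1 > (0 :: real)" by (simp add: harm_expand)
  then show ?thesis using \<gamma>_ge_1 by (simp add: \<alpha>_def)
qed

lemma measurable_toll [measurable]: "toll K \<in> borel_measurable (uniforms K)"
  unfolding toll_def[abs_def] using K by measurable

lemma abs_mult_ln_le_1:
  assumes "0 \<le> x" "x \<le> (1::real)"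
  shows "\<bar>x * ln x\<bar> \<le> 1"
proof (cases "x = 0")
  case False
  with assms have "x > 0" by simp
  have "ln (1 / x) \<le> 1 / x - 1" using \<open>x > 0\<close> by (intro ln_le_minus_one) simp
  then have "x * - ln x \<le> x * (1 / x)"
    using \<open>x > 0\<close> by (intro mult_left_mono) (auto simp: ln_div)
  moreover have "x * ln x \<le> 0" using assms \<open>x > 0\<close> by (simp add: mult_nonneg_nonpos)
  ultimately show ?thesis using \<open>x > 0\<close> by (simp add: abs_if)
qed simp

lemma abs_toll_le:
  assumes "u \<in> unit_points K"
  shows "\<bar>toll K u\<bar> \<le> (real K + 1) * \<alpha> K + real K"
proof -
  have "\<bar>\<Sum>i=0..K. \<alpha> K * spacing K u i * ln (spacing K u i)\<bar>
      \<le> (\<Sum>i=0..K. \<bar>\<alpha> K * spacing K u i * ln (spacing K u i)\<bar>)" by (rule sum_abs)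
  also have "\<dots> \<le> (\<Sum>i=0..K. \<alpha> K * 1)"
  proof (rule sum_mono)
    fix i assume "i \<in> {0..K}"
    then have "\<bar>spacing K u i * ln (spacing K u i)\<bar> \<le> 1"
      using spacing_nonneg[OF K assms] spacing_le_1[OF K assms] by (intro abs_mult_ln_le_1) auto
    then have "\<alpha> K * \<bar>spacing K u i * ln (spacing K u i)\<bar> \<le> \<alpha> K * 1"
      using \<alpha>_pos by (intro mult_left_mono) auto
    then show "\<bar>\<alpha> K * spacing K u i * ln (spacing K u i)\<bar> \<le> \<alpha> K * 1"
      using \<alpha>_pos by (simp add: abs_mult mult.assoc)
  qed
  finally have "\<bar>\<Sum>i=0..K. \<alpha> K * spacing K u i * ln (spacing K u i)\<bar> \<le> (real K + 1) * \<alpha> K"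
    by (simp add: algebra_simps)
  moreover have "\<bar>l_opt K (spacing K u)\<bar> \<le> real K"
    using l_opt_spacing_le[OF assms] l_opt_spacing_ge_1[OF assms] by simp
  ultimately show ?thesis unfolding toll_def by linarith
qed

lemma integrable_spacing_power:
  "i \<le> K \<Longrightarrow> integrable (uniforms K) (\<lambda>u. spacing K u i ^ q)"
proof -
  assume i: "i \<le> K"
  interpret U: prob_space "uniforms K" by (rule prob_space_uniforms)
  show ?thesis
  proof (rule U.integrable_const_bound[where B = 1])
    show "AE u in uniforms K. norm (spacing K u i ^ q) \<le> 1"
      using AE_unit_points
      by eventually_elim (use i spacing_nonneg[OF K] spacing_le_1[OF K] in \<open>auto simp: power_le_one\<close>)
  qed (use K in measurable)
qed

text \<open>If both outer spacings are at least \<open>e\<close>, every spacing is at most 1 - e,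
  and D ^ q \<le> D * D \<le> (1 - e) * D sums to 1 - e. Otherwise the sum is at most 1. The bound
  \<open>s\<close> is the same for all exponents q \<ge> 2.\<close>

lemma expectation_sum_spacing_power:
  "\<exists>s\<in>{0<..<1}. \<forall>q\<ge>2. (\<Sum>i=0..K. \<integral>u. spacing K u i ^ q \<partial>uniforms K) \<le> s"
proof -
  interpret U: prob_space "uniforms K" by (rule prob_space_uniforms)
  \<comment> \<open>Chosen so that the bad event has probability at most 2 * K * e = 2 / 3.\<close>
  define e where "e = 1 / (3 * real K)"
  have e: "0 < e" "e \<le> 1 / 3" using K by (auto simp: e_def field_simps)
  define B where "B = {u \<in> space (uniforms K). spacing K u 0 < e \<or> spacing K u K < e}"
  have B: "B \<in> sets (uniforms K)" unfolding B_def using K by measurable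
  have PB: "measure (uniforms K) B \<le> 2 / 3"
    using prob_small_first_or_last_spacing[OF K, of e] e K by (simp add: B_def e_def)
  have le: "(\<Sum>i=0..K. spacing K u i ^ q) \<le> 1 - e + e * indicator B u"
    if u: "u \<in> unit_points K" "u \<in> space (uniforms K)" and q: "q \<ge> 2" for u q
  proof -
    note D0 = spacing_nonneg[OF K u(1)] and D1 = spacing_le_1[OF K u(1)]
    have sq: "spacing K u i ^ q \<le> spacing K u i * spacing K u i" if "i \<le> K" for i
      using power_decreasing[OF q, of "spacing K u i"] D0[OF that] D1[OF that]
      by (simp add: power2_eq_square)
    show ?thesis
    proof (cases "u \<in> B")
      case True
      have "(\<Sum>i=0..K. spacing K u i ^ q) \<le> (\<Sum>i=0..K. spacing K u i)"
        by (rule sum_mono) (use sq D0 D1 in \<open>force intro: order_trans mult_left_le\<close>)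
      then show ?thesis using True sum_spacing[OF K] by simp
    next
      case False
      then have ends: "spacing K u 0 \<ge> e" "spacing K u K \<ge> e" using u by (auto simp: B_def)
      have D: "spacing K u i \<le> 1 - e" if "i \<le> K" for i
      proof -
        \<comment> \<open>An outer index different from \<open>i\<close>: the two spacings together
          are at most 1, so the \<open>i\<close>-th is at most 1 - e.\<close>
        define j where "j = (if i = 0 then K else 0)"
        have "(\<Sum>k\<in>{i, j}. spacing K u k) \<le> (\<Sum>k=0..K. spacing K u k)"
          using that D0 by (intro sum_mono2) (auto simp: j_def)
        moreover have "i \<noteq> j" "spacing K u j \<ge> e" using K ends by (auto simp: j_def)
        ultimately show ?thesis using sum_spacing[OF K, of u] by simp
      qed
      have "(\<Sum>i=0..K. spacing K u i ^ q) \<le> (\<Sum>i=0..K. (1 - e) * spacing K u i)"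
        by (rule sum_mono) (use sq D0 D in \<open>force intro: order_trans mult_right_mono\<close>)
      also have "\<dots> = 1 - e" using sum_spacing[OF K] by (simp add: sum_distrib_left[symmetric])
      finally show ?thesis using False by simp
    qed
  qed
  have "(\<Sum>i=0..K. \<integral>u. spacing K u i ^ q \<partial>uniforms K) \<le> 1 - e / 3" if "q \<ge> 2" for q
  proof -
    have "(\<Sum>i=0..K. \<integral>u. spacing K u i ^ q \<partial>uniforms K) =
        (\<integral>u. (\<Sum>i=0..K. spacing K u i ^ q) \<partial>uniforms K)"
      by (rule Bochner_Integration.integral_sum[symmetric]) (auto intro: integrable_spacing_power)
    also have "\<dots> \<le> (\<integral>u. 1 - e + e * indicator B u \<partial>uniforms K)"
    proof (rule integral_mono_AE)
      show "AE u in uniforms K. (\<Sum>i=0..K. spacing K u i ^ q) \<le> 1 - e + e * indicator B u"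
        using AE_unit_points AE_space by eventually_elim (use le that in auto)
    qed (use B in \<open>auto intro!: Bochner_Integration.integrable_sum integrable_spacing_power simp: U.emeasure_eq_measure\<close>)
    also have "\<dots> = 1 - e + e * measure (uniforms K) B"
      using B by (subst Bochner_Integration.integral_add) (auto simp: U.prob_space U.emeasure_eq_measure)
    also have "\<dots> \<le> 1 - e + e * (2 / 3)"
      using mult_left_mono[OF PB, of e] e by linarith
    finally show ?thesis by simp
  qed
  then show ?thesis using e by (intro bexI[of _ "1 - e / 3"]) auto
qed

end

section \<open>Dependence on a single pivot\<close>

lemma sorted_filter_less:
  fixes s :: "'a :: linorder list"
  assumes "sorted s"
  shows "\<exists>j\<le>length s. filter (\<lambda>v. v < m) s = take j s \<and> filter (\<lambda>v. \<not> v < m) s = drop j s"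
  using assms
proof (induction s)
  case (Cons a s)
  show ?case
  proof (cases "a < m")
    case True
    from Cons obtain j where "j \<le> length s" "filter (\<lambda>v. v < m) s = take j s"
      "filter (\<lambda>v. \<not> v < m) s = drop j s" by auto
    then show ?thesis using True by (intro exI[of _ "Suc j"]) auto
  next
    case False
    then have "\<forall>v\<in>set (a # s). \<not> v < m" using Cons.prems by fastforce
    then show ?thesis by (intro exI[of _ 0]) (auto simp: filter_empty_conv filter_id_conv)
  qed
qed simp

text \<open>Writing insertion through filters exposes the rank of \<open>y\<close>, which stays
  fixed as long as \<open>y\<close> does not cross another point.\<close>

lemma sort_Cons_filter:
  fixes s :: "'a :: linorder list"
  shows "sort (y # xs) = filter (\<lambda>v. v < y) (sort xs) @ y # filter (\<lambda>v. \<not> v < y) (sort xs)"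
proof (rule properties_for_sort)
  show "mset (filter (\<lambda>v. v < y) (sort xs) @ y # filter (\<lambda>v. \<not> v < y) (sort xs)) = mset (y # xs)"
    by simp
  show "sorted (filter (\<lambda>v. v < y) (sort xs) @ y # filter (\<lambda>v. \<not> v < y) (sort xs))"
    by (auto simp: sorted_append sorted_filter[of id, simplified] intro: less_imp_le order_less_le_trans)
qed

definition recursion_value :: "nat \<Rightarrow> (nat \<Rightarrow> real) \<Rightarrow> (nat \<Rightarrow> real) \<Rightarrow> real" where
  "recursion_value K z u = (\<Sum>i=0..K. spacing K u i * z i) + toll K u"

context
  fixes K :: nat and x :: "nat \<Rightarrow> real"
  assumes K: "K \<ge> 1"
begin

definition other_points :: "real list" where
  "other_points = sort (map x [2..<Suc K])"

text \<open>If the first pivot \<open>y\<close> has rank \<open>j\<close> (counted from \<open>0\<close>), then the \<open>i\<close>-th spacing is the affine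
  function \<open>spacing_const j i + spacing_slope j i * y\<close>.\<close>

definition spacing_const :: "nat \<Rightarrow> nat \<Rightarrow> real" where
  "spacing_const j i =
     (let E = 0 # take j other_points @ 0 # drop j other_points @ [1] in E ! Suc i - E ! i)"

definition spacing_slope :: "nat \<Rightarrow> nat \<Rightarrow> real" where
  "spacing_slope j i = (if i = j then 1 else if i = Suc j then - 1 else 0)"

definition affine_cost :: "nat \<Rightarrow> nat tree \<Rightarrow> real \<Rightarrow> real" where
  "affine_cost j t y = tree_cost K t (\<lambda>i. spacing_const j i + spacing_slope j i * y)"

text \<open>The points at which the affine costs of two trees agree. For parallel costs, division by
  zero contributes the point 0, which is harmless.\<close>

definition cost_crossings :: "nat \<Rightarrow> real set" where
  "cost_crossings j = (\<lambda>(t, t'). (affine_cost j t' 0 - affine_cost j t 0) /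
     ((affine_cost j t 1 - affine_cost j t 0) - (affine_cost j t' 1 - affine_cost j t' 0)))
     ` (search_trees K \<times> search_trees K)"

text \<open>Away from these points both the rank of the moving pivot and the comparison of any two
  tree costs are locally constant. Crossings are collected for every rank, so the set does not
  depend on the position of the moving pivot.\<close>

definition exceptional_points :: "real set" where
  "exceptional_points = set other_points \<union> (\<Union>j<K. cost_crossings j)"

lemma length_other_points: "length other_points = K - 1"
  by (simp add: other_points_def del: upt_Suc)

lemma finite_exceptional_points: "finite exceptional_points"
  unfolding exceptional_points_def cost_crossings_def using finite_search_trees by auto

text \<open>The bound depends on \<open>K\<close> alone; this makes the oscillation estimate uniform
  in the other pivots.\<close>

lemma card_exceptional_points:
  "card exceptional_points \<le> K + K * (card (search_trees K) * card (search_trees K))"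
proof -
  have "card exceptional_points \<le> card (set other_points) + card (\<Union>j<K. cost_crossings j)"
    unfolding exceptional_points_def by (rule card_Un_le)
  also have "\<dots> \<le> K + (\<Sum>j<K. card (cost_crossings j))"
    using card_length[of other_points] length_other_points
    by (intro add_mono card_UN_le) auto
  also have "\<dots> \<le> K + (\<Sum>j<K. card (search_trees K) * card (search_trees K))"
  proof (intro add_mono order_refl sum_mono)
    fix j
    have "card (cost_crossings j) \<le> card (search_trees K \<times> search_trees K)"
      unfolding cost_crossings_def using finite_search_trees
      by (intro card_image_le finite_cartesian_product)
    then show "card (cost_crossings j) \<le> card (search_trees K) * card (search_trees K)"
      by (simp add: card_cartesian_product)
  qed
  finally show ?thesis by simp
qed

lemma affine_cost_eq:
  "affine_cost j t y = affine_cost j t 0 + (affine_cost j t 1 - affine_cost j t 0) * y"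
  by (simp add: affine_cost_def tree_cost_def algebra_simps sum.distrib sum_distrib_left)

lemma spacing_first_pivot:
  assumes "filter (\<lambda>v. v < y) other_points = take j other_points"
    "filter (\<lambda>v. \<not> v < y) other_points = drop j other_points" "j < K" "i \<le> K"
  shows "spacing K (x(1 := y)) i = spacing_const j i + spacing_slope j i * y"
proof -
  have "map (x(1 := y)) [1..<Suc K] = y # map x [2..<Suc K]"
    using K by (simp add: upt_conv_Cons numeral_2_eq_2 del: upt_Suc)
  then have E: "bounded_order_stats K (x(1 := y)) = 0 # take j other_points @ y # drop j other_points @ [1]"
    unfolding bounded_order_stats_def using assms sort_Cons_filter[of y "map x [2..<Suc K]"]
    by (simp add: other_points_def del: upt_Suc)
  have j: "length (take j other_points) = j" using assms length_other_points by simp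
  define Ey where "Ey = 0 # take j other_points @ y # drop j other_points @ [1]"
  define E0 where "E0 = 0 # take j other_points @ 0 # drop j other_points @ [1]"
  \<comment> \<open>The leading 0 shifts rank \<open>j\<close> to position \<open>Suc j\<close>, the
    only place where the two lists differ.\<close>
  have nth: "Ey ! k = E0 ! k + (if k = Suc j then y else 0)" for k
    using j unfolding Ey_def E0_def by (cases k) (auto simp: nth_append nth_Cons')
  have "spacing K (x(1 := y)) i = Ey ! Suc i - Ey ! i"
    unfolding spacing_eq_diff[OF K assms(4)] E Ey_def ..
  moreover have "spacing_const j i = E0 ! Suc i - E0 ! i"
    by (simp only: spacing_const_def Let_def E0_def)
  ultimately show ?thesis
    by (auto simp: nth spacing_slope_def)
qed

text \<open>A tree optimal at the midpoint stays optimal on the whole gap: the difference of two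
  affine costs could change sign only at a crossing.\<close>

lemma optimal_tree_constant:
  assumes "c < d" "{c<..<d} \<inter> exceptional_points = {}"
  shows "\<exists>j<K. \<exists>t\<in>search_trees K. \<forall>y\<in>{c<..<d}.
    (\<forall>i\<le>K. spacing K (x(1 := y)) i = spacing_const j i + spacing_slope j i * y) \<and>
    l_opt K (spacing K (x(1 := y))) = affine_cost j t y"
proof -
  define m where "m = (c + d) / 2"
  have m: "m \<in> {c<..<d}" using \<open>c < d\<close> by (auto simp: m_def)
  have "sorted other_points" by (simp add: other_points_def)
  then obtain j where j: "j \<le> length other_points"
    "filter (\<lambda>v. v < m) other_points = take j other_points"
    "filter (\<lambda>v. \<not> v < m) other_points = drop j other_points"
    using sorted_filter_less by blast
  have jK: "j < K" using j length_other_points K by simp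
  have less: "v < y \<longleftrightarrow> v < m" if "y \<in> {c<..<d}" "v \<in> set other_points" for v y
  proof -
    have "v \<notin> {c<..<d}" using that assms(2) by (auto simp: exceptional_points_def)
    then show ?thesis using that m by auto
  qed
  have sp: "spacing K (x(1 := y)) i = spacing_const j i + spacing_slope j i * y"
    if "y \<in> {c<..<d}" "i \<le> K" for y i
  proof (rule spacing_first_pivot)
    show "filter (\<lambda>v. v < y) other_points = take j other_points"
      unfolding j(2)[symmetric] using less[OF that(1)] by (intro filter_cong) auto
    show "filter (\<lambda>v. \<not> v < y) other_points = drop j other_points"
      unfolding j(3)[symmetric] using less[OF that(1)] by (intro filter_cong) auto
  qed (use jK that in auto)
  have cost: "tree_cost K t (spacing K (x(1 := y))) = affine_cost j t y" if "y \<in> {c<..<d}" for t y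
    unfolding tree_cost_def affine_cost_def using sp[OF that] by (intro sum.cong) auto
  have "Min ((\<lambda>t. affine_cost j t m) ` search_trees K) \<in> (\<lambda>t. affine_cost j t m) ` search_trees K"
    using finite_search_trees search_trees_nonempty by (intro Min_in) auto
  then obtain t where t: "t \<in> search_trees K"
    "affine_cost j t m = Min ((\<lambda>t. affine_cost j t m) ` search_trees K)" by auto
  have tmin: "affine_cost j t m \<le> affine_cost j t' m" if "t' \<in> search_trees K" for t'
    unfolding t(2) using that finite_search_trees by (intro Min_le) auto
  have opt: "affine_cost j t y \<le> affine_cost j t' y" if y: "y \<in> {c<..<d}" and t': "t' \<in> search_trees K" for y t'
  proof (rule ccontr)
    assume neg: "\<not> ?thesis"
    define f where "f v = affine_cost j t v - affine_cost j t' v" for v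
    define q where "q = (affine_cost j t 1 - affine_cost j t 0) - (affine_cost j t' 1 - affine_cost j t' 0)"
    define r where "r = (affine_cost j t' 0 - affine_cost j t 0) / q"
    have f: "f v = f 0 + q * v" for v
      unfolding f_def q_def using affine_cost_eq[of j t v] affine_cost_eq[of j t' v]
      by (simp add: algebra_simps)
    have fm: "f m \<le> 0" "f y > 0" using tmin[OF t'] neg by (auto simp: f_def)
    then have q: "q \<noteq> 0" using f[of m] f[of y] by auto
    have "r = - f 0 / q" by (simp add: r_def f_def)
    \<comment> \<open>The difference of costs vanishes only at \<open>r\<close>, which lies outside
      the gap; hence its values at \<open>m\<close> and \<open>y\<close> have the same strict
      sign.\<close>
    then have fr: "f v = q * (v - r)" for v using q f[of v] by (simp add: field_simps)
    have qq: "0 < q * q" using q by (metis not_real_square_gt_zero)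
    have "r \<in> cost_crossings j"
      unfolding cost_crossings_def r_def q_def using t(1) t' by force
    then have "r \<notin> {c<..<d}" using assms(2) jK by (auto simp: exceptional_points_def)
    then have "r \<le> c \<or> d \<le> r" by auto
    then have "0 < f m * f y"
    proof
      assume "r \<le> c"
      then have "0 < (q * q) * ((m - r) * (y - r))" using m y by (intro mult_pos_pos[OF qq]) auto
      then show ?thesis by (simp add: fr ac_simps)
    next
      assume "d \<le> r"
      then have "0 < (q * q) * ((m - r) * (y - r))" using m y qq
        by (intro mult_pos_pos[OF qq] mult_neg_neg) auto
      then show ?thesis by (simp add: fr ac_simps)
    qed
    then show False using fm by (simp add: zero_less_mult_iff)
  qed
  have "l_opt K (spacing K (x(1 := y))) = affine_cost j t y" if "y \<in> {c<..<d}" for y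
    unfolding l_opt_def cost[OF that]
    using t opt that finite_search_trees by (intro Min_eqI) auto
  then show ?thesis using jK t sp by blast
qed

text \<open>In the derivative of the phase the copies \<open>z\<close> and the tree depths are
  constants, so only the logarithms drive its growth. The \<open>j\<close>-th spacing is increasing
  and at most 1, hence its logarithm has slope at least 1; the spacing with index j + 1 has
  coefficient -1 and decreases, so it contributes with the same sign.\<close>

lemma recursion_value_oscillation:
  assumes cd: "0 \<le> c" "c < d" "d \<le> 1" and exc: "{c<..<d} \<inter> exceptional_points = {}"
    and unit: "\<And>i. i \<in> {2..K} \<Longrightarrow> x i \<in> {0..1}"
    and \<tau>: "\<tau> > 0" and pq: "c < p" "p \<le> q" "q < d"
  shows "\<bar>integral {p..q} (\<lambda>y. cos (\<tau> * recursion_value K z (x(1 := y)) + \<theta>))\<bar> \<le> 10 / sqrt (\<tau> * \<alpha> K)"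
proof -
  obtain j t where j: "j < K" and t: "t \<in> search_trees K"
    and sp: "\<And>y i. y \<in> {c<..<d} \<Longrightarrow> i \<le> K \<Longrightarrow>
      spacing K (x(1 := y)) i = spacing_const j i + spacing_slope j i * y"
    and lo: "\<And>y. y \<in> {c<..<d} \<Longrightarrow> l_opt K (spacing K (x(1 := y))) = affine_cost j t y"
    using optimal_tree_constant[OF cd(2) exc] by blast
  define s where "s = spacing_slope j"
  define D where "D i y = spacing_const j i + s i * y" for i y
  have up: "x(1 := y) \<in> unit_points K" if "y \<in> {c<..<d}" for y
    using unit that cd by (fastforce simp: unit_points_def)
  have D0: "0 \<le> D i y" and D1: "D i y \<le> 1" if "y \<in> {c<..<d}" "i \<le> K" for i y
    using spacing_nonneg[OF K up[OF that(1)] that(2)] spacing_le_1[OF K up[OF that(1)] that(2)]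
    unfolding D_def s_def sp[OF that] by simp_all
  have s: "s i = 1 \<or> s i = -1 \<or> s i = 0" for i by (auto simp: s_def spacing_slope_def)
  \<comment> \<open>Moving the pivot by \<open>h\<close> in the direction that shrinks the spacing
    stays in the gap and lowers it by \<open>h\<close>; since the new value is nonnegative, the old
    one is positive.\<close>
  have Dpos: "0 < D i y" if y: "y \<in> {c<..<d}" and i: "i \<le> K" "s i \<noteq> 0" for i y
  proof -
    define h where "h = min (y - c) (d - y) / 2"
    have h: "h > 0" "y + h \<in> {c<..<d}" "y - h \<in> {c<..<d}"
      using y by (auto simp: h_def min_def field_simps)
    have "s i * s i = 1" using s[of i] i by auto
    then have "D i (y - s i * h) = D i y - h" by (simp add: D_def algebra_simps flip: mult.assoc)
    moreover have "y - s i * h \<in> {c<..<d}" using s[of i] h by auto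
    ultimately show ?thesis using D0[of "y - s i * h" i] h i by simp
  qed
  define \<Psi> where "\<Psi> y = (\<Sum>i=0..K. D i y * z i) + ((\<Sum>i=0..K. \<alpha> K * D i y * ln (D i y)) +
      (\<Sum>i=0..K. D i y * real (leaf_depths t ! i)))" for y
  define \<Psi>' where "\<Psi>' y = (\<Sum>i=0..K. s i * z i) + ((\<Sum>i=0..K. \<alpha> K * s i * (ln (D i y) + 1)) +
      (\<Sum>i=0..K. s i * real (leaf_depths t ! i)))" for y
  have \<Psi>: "recursion_value K z (x(1 := y)) = \<Psi> y" if "y \<in> {c<..<d}" for y
    unfolding recursion_value_def toll_def lo[OF that] \<Psi>_def affine_cost_def tree_cost_def
    using sp[OF that] by (simp add: D_def s_def)
  have dD: "(D i has_real_derivative s i) (at y)" for i y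
    unfolding D_def by (auto intro!: derivative_eq_intros)
  have dDln: "((\<lambda>y. \<alpha> K * D i y * ln (D i y)) has_real_derivative \<alpha> K * s i * (ln (D i y) + 1)) (at y)"
    if y: "y \<in> {c<..<d}" and i: "i \<le> K" for i y
  proof (cases "s i = 0")
    case True
    then show ?thesis by (simp add: D_def)
  next
    case False
    then have "0 < D i y" using Dpos y i by simp
    then show ?thesis by (auto intro!: derivative_eq_intros dD simp: field_simps)
  qed
  have d\<Psi>: "(\<Psi> has_real_derivative \<Psi>' y) (at y)" if "y \<in> {c<..<d}" for y
    unfolding \<Psi>_def \<Psi>'_def
    by (intro DERIV_add DERIV_sum dDln that DERIV_cmult_right dD) auto
  \<comment> \<open>The left side keeps only the contribution of the \<open>j\<close>-th spacing and
    drops the nonnegative remainder.\<close>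
  have lnterm: "(if i = j then v - w else 0) \<le> s i * (ln (D i v) - ln (D i w))"
    if vw: "w \<in> {c<..<d}" "v \<in> {c<..<d}" "w \<le> v" and i: "i \<le> K" for i v w
  proof (cases "s i = 0")
    case True
    then show ?thesis by (auto simp: s_def spacing_slope_def split: if_splits)
  next
    case False
    note pos = Dpos[OF vw(1) i False] Dpos[OF vw(2) i False]
    consider "s i = 1" | "s i = -1" "i \<noteq> j" using s[of i] s[of j] False
      by (cases "i = j") (auto simp: s_def spacing_slope_def)
    then show ?thesis
    proof cases
      case 1
      have "ln (D i w) - ln (D i v) \<le> (D i w - D i v) / D i v" using pos by (intro ln_diff_le)
      also have "\<dots> \<le> (D i w - D i v) / 1"
        using pos D1[OF vw(2) i] vw 1 by (intro divide_left_mono_neg) (auto simp: D_def)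
      finally show ?thesis using 1 vw by (auto simp: D_def)
    next
      case 2
      then have "D i v \<le> D i w" using vw by (simp add: D_def)
      then show ?thesis using 2 pos by simp
    qed
  qed
  have grow: "\<alpha> K * (v - w) \<le> \<Psi>' v - \<Psi>' w"
    if vw: "w \<in> {c<..<d}" "v \<in> {c<..<d}" "w \<le> v" for v w
  proof -
    have "v - w = (\<Sum>i=0..K. if i = j then v - w else 0)" using j by simp
    also have "\<dots> \<le> (\<Sum>i=0..K. s i * (ln (D i v) - ln (D i w)))"
      using lnterm[OF vw] by (intro sum_mono) auto
    finally have "\<alpha> K * (v - w) \<le> \<alpha> K * (\<Sum>i=0..K. s i * (ln (D i v) - ln (D i w)))"
      using \<alpha>_pos[OF K] by (intro mult_left_mono) auto
    also have "\<dots> = \<Psi>' v - \<Psi>' w"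
      by (simp add: \<Psi>'_def sum_distrib_left algebra_simps flip: sum_subtractf)
    finally show ?thesis .
  qed
  have sub: "y \<in> {c<..<d}" if "p \<le> y" "y \<le> q" for y using that pq by auto
  have cont\<Psi>: "continuous_on {p..q} \<Psi>'"
    unfolding \<Psi>'_def
  proof (intro continuous_on_add continuous_on_const continuous_on_sum)
    fix i assume i: "i \<in> {0..K}"
    show "continuous_on {p..q} (\<lambda>y. \<alpha> K * s i * (ln (D i y) + 1))"
    proof (cases "s i = 0")
      case False
      have "D i y \<noteq> 0" if "y \<in> {p..q}" for y
        using Dpos[OF sub, of y i] False that i by auto
      then show ?thesis unfolding D_def by (intro continuous_intros) auto
    qed simp
  qed
  have "\<bar>integral {p..q} (\<lambda>y. cos (\<tau> * \<Psi> y + \<theta>))\<bar> \<le> 10 / sqrt (\<tau> * \<alpha> K)"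
  proof (rule van_der_Corput[where \<psi>' = "\<lambda>y. \<tau> * \<Psi>' y"])
    show "0 < \<tau> * \<alpha> K" using \<tau> \<alpha>_pos[OF K] by simp
    show "((\<lambda>y. \<tau> * \<Psi> y + \<theta>) has_real_derivative \<tau> * \<Psi>' y) (at y)" if "p \<le> y" "y \<le> q" for y
      using d\<Psi>[OF sub[OF that]] by (auto intro!: derivative_eq_intros)
    show "\<tau> * \<alpha> K * (v - w) \<le> \<tau> * \<Psi>' v - \<tau> * \<Psi>' w" if "p \<le> w" "w \<le> v" "v \<le> q" for v w
      using mult_left_mono[OF grow[of w v], of \<tau>] sub[of w] sub[of v] that \<tau>
      by (simp add: algebra_simps)
  qed (use pq cont\<Psi> in \<open>auto intro!: continuous_intros\<close>)
  also have "integral {p..q} (\<lambda>y. cos (\<tau> * \<Psi> y + \<theta>)) =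
      integral {p..q} (\<lambda>y. cos (\<tau> * recursion_value K z (x(1 := y)) + \<theta>))"
    using \<Psi> sub by (intro Henstock_Kurzweil_Integration.integral_cong) auto
  finally show ?thesis .
qed

end

section \<open>The characteristic function of the limit law\<close>

text \<open>Passes from expectations over a pivot to the gauge integrals for which the oscillation
  estimates are stated.\<close>

lemma integral_uniform_unit:
  fixes f :: "real \<Rightarrow> real"
  assumes [measurable]: "f \<in> borel_measurable borel" and "\<And>x. \<bar>f x\<bar> \<le> 1"
  shows "(\<integral>y. f y \<partial>uniform_measure lborel {0..1}) = integral {0..1} f"
proof -
  have si: "set_integrable lborel {0..1} f"
    unfolding set_integrable_def
  proof (rule integrableI_bounded_set_indicator[where B = 1])
    show "AE x in lborel. x \<in> {0..1} \<longrightarrow> norm (f x) \<le> 1" using assms by auto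
  qed auto
  have "uniform_measure lborel {0..1::real} = density lborel (\<lambda>x. ennreal (indicator {0..1} x))"
    unfolding uniform_measure_def by (intro density_cong) (auto simp: divide_ennreal_def indicator_def)
  then have "(\<integral>y. f y \<partial>uniform_measure lborel {0..1}) = (LINT x:{0..1}|lborel. f x)"
    by (simp add: integral_density set_lebesgue_integral_def)
  also have "\<dots> = integral {0..1} f" using si by (rule set_borel_integral_eq_integral)
  finally show ?thesis .
qed

lemma integrable_on_interval_bounded:
  fixes f :: "real \<Rightarrow> real"
  assumes [measurable]: "f \<in> borel_measurable borel" and "\<And>x. \<bar>f x\<bar> \<le> 1"
  shows "f integrable_on {p..q}"
proof -
  have "set_integrable lborel {p..q} f"
    unfolding set_integrable_def
  proof (rule integrableI_bounded_set_indicator[where B = 1])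
    show "AE x in lborel. x \<in> {p..q} \<longrightarrow> norm (f x) \<le> 1" using assms by auto
  qed (auto simp: emeasure_lborel_Icc_eq)
  then show ?thesis by (rule set_borel_integral_eq_integral)
qed

context
  fixes K :: nat
  assumes K: "K \<ge> 1"
begin

lemma measurable_recursion_value:
  assumes "sets \<mu> = sets borel"
  shows "(\<lambda>(z, u). recursion_value K z u) \<in>
    borel_measurable ((\<Pi>\<^sub>M i\<in>{0..K}. \<mu>) \<Otimes>\<^sub>M uniforms K)"
proof -
  have z: "(\<lambda>z. z i) \<in> borel_measurable (\<Pi>\<^sub>M i\<in>{0..K}. \<mu>)" if "i \<in> {0..K}" for i
    using measurable_component_singleton[OF that, of "\<lambda>_. \<mu>"] assms
      measurable_cong_sets[OF refl assms] by blast
  have "(\<lambda>p. recursion_value K (fst p) (snd p)) \<in> borel_measurable ((\<Pi>\<^sub>M i\<in>{0..K}. \<mu>) \<Otimes>\<^sub>M uniforms K)"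
    unfolding recursion_value_def
    by (intro borel_measurable_add borel_measurable_sum borel_measurable_times
        measurable_compose[OF measurable_snd measurable_toll[OF K]]
        measurable_compose[OF measurable_snd measurable_spacing[OF K]]
        measurable_compose[OF measurable_fst z])
  then show ?thesis by (simp add: case_prod_beta')
qed

lemma measurable_recursion_value_snd:
  "recursion_value K z \<in> borel_measurable (uniforms K)"
proof -
  show ?thesis unfolding recursion_value_def[abs_def]
    by (intro borel_measurable_add borel_measurable_sum borel_measurable_times
        borel_measurable_const measurable_toll[OF K] measurable_spacing[OF K])
qed

lemma measurable_first_pivot:
  assumes "x \<in> space (\<Pi>\<^sub>M i\<in>{2..K}. uniform_measure lborel {0..1::real})"
  shows "(\<lambda>y. x(1 := y)) \<in> borel \<rightarrow>\<^sub>M uniforms K"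
  unfolding uniforms_def
proof (rule measurable_fun_upd)
  show "{1..K} = {2..K} \<union> {1}" using K by auto
  show "(\<lambda>y. x) \<in> borel \<rightarrow>\<^sub>M (\<Pi>\<^sub>M i\<in>{2..K}. uniform_measure lborel {0..1::real})"
    using assms by simp
qed (simp add: measurable_ident_sets)

text \<open>The factor 20 is the constant 10 of the oscillation estimate, doubled for real and
  imaginary part. The bracket bounds the number of pieces, and sqrt (\<alpha> K) comes from the
  growth rate \<tau> * \<alpha> K.\<close>

definition piece_bound :: real where
  "piece_bound = 20 * (real (K + K * (card (search_trees K) * card (search_trees K))) + 1) / sqrt (\<alpha> K)"

lemma cos_recursion_value_bound:
  assumes x: "x \<in> space (\<Pi>\<^sub>M i\<in>{2..K}. uniform_measure lborel {0..1::real})"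
    and unit: "\<And>i. i \<in> {2..K} \<Longrightarrow> x i \<in> {0..1}" and \<tau>: "\<tau> > 0"
  shows "\<bar>\<integral>y. cos (\<tau> * recursion_value K z (x(1 := y)) + \<theta>) \<partial>uniform_measure lborel {0..1}\<bar>
    \<le> piece_bound / 2 / sqrt \<tau>"
proof -
  define R where "R y = recursion_value K z (x(1 := y))" for y
  define F where "F y = cos (\<tau> * R y + \<theta>)" for y
  have [measurable]: "R \<in> borel_measurable borel"
    unfolding R_def[abs_def] by (rule measurable_compose[OF measurable_first_pivot[OF x] measurable_recursion_value_snd])
  have F: "F \<in> borel_measurable borel" "\<And>y. \<bar>F y\<bar> \<le> 1"
    unfolding F_def[abs_def] by auto
  note int = integrable_on_interval_bounded[OF F]
  have "\<bar>integral {0..1} F\<bar> \<le>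
      (real (card (exceptional_points K x)) + 1) * (10 / sqrt (\<tau> * \<alpha> K))"
  proof (rule integral_bound_finite_exceptions[OF finite_exceptional_points[OF K] int])
    fix c d :: real
    assume cd: "0 \<le> c" "c < d" "d \<le> 1" "{c<..<d} \<inter> exceptional_points K x = {}"
    show "\<bar>integral {c..d} F\<bar> \<le> 10 / sqrt (\<tau> * \<alpha> K)"
      unfolding F_def R_def
      by (rule integral_bound_open_interval[OF cd(2)],
          rule int[unfolded F_def R_def], simp,
          rule recursion_value_oscillation[OF K cd unit \<tau>])
  qed simp
  also have "\<dots> \<le> (real (K + K * (card (search_trees K) * card (search_trees K))) + 1) * (10 / sqrt (\<tau> * \<alpha> K))"
    using card_exceptional_points[OF K, of x] \<tau> \<alpha>_pos[OF K]
    by (intro mult_right_mono) (auto simp del: of_nat_add of_nat_mult)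
  also have "\<dots> = piece_bound / 2 / sqrt \<tau>"
  proof -
    have "N * (10 / (a * b)) = 20 * N / b / 2 / a" for N a b :: real by (simp add: mult.commute)
    then show ?thesis unfolding piece_bound_def real_sqrt_mult .
  qed
  finally show ?thesis
    unfolding F_def[abs_def, unfolded R_def, symmetric] integral_uniform_unit[OF F] .
qed

text \<open>The phase shifts 0 and -pi / 2 turn the cosine estimate into bounds for the real and the
  imaginary part.\<close>

lemma iexp_recursion_value_bound:
  assumes x: "x \<in> space (\<Pi>\<^sub>M i\<in>{2..K}. uniform_measure lborel {0..1::real})"
    and unit: "\<And>i. i \<in> {2..K} \<Longrightarrow> x i \<in> {0..1}" and \<tau>: "\<tau> > 0"
  shows "cmod (\<integral>y. iexp (\<tau> * recursion_value K z (x(1 := y))) \<partial>uniform_measure lborel {0..1})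
    \<le> piece_bound / sqrt \<tau>"
proof -
  let ?U = "uniform_measure lborel {0..1::real}"
  define R where "R y = \<tau> * recursion_value K z (x(1 := y))" for y
  have [measurable]: "R \<in> borel_measurable borel"
    unfolding R_def[abs_def]
    by (intro borel_measurable_times borel_measurable_const
        measurable_compose[OF measurable_first_pivot[OF x] measurable_recursion_value_snd])
  have int: "integrable ?U (\<lambda>y. iexp (R y))"
  proof (rule uniform_unit.integrable_const_bound[where B = 1])
    show "(\<lambda>y. iexp (R y)) \<in> borel_measurable ?U"
      by measurable
  qed simp
  have "Re (\<integral>y. iexp (R y) \<partial>?U) = (\<integral>y. cos (R y + 0) \<partial>?U)"
    by (subst integral_Re[OF int, symmetric]) (simp add: Re_exp)
  moreover have "Im (\<integral>y. iexp (R y) \<partial>?U) = (\<integral>y. cos (R y + - (pi / 2)) \<partial>?U)"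
    by (subst integral_Im[OF int, symmetric]) (simp add: Im_exp cos_diff)
  ultimately show ?thesis
    using cmod_le[of "\<integral>y. iexp (R y) \<partial>?U"] cos_recursion_value_bound[OF assms, of z 0]
      cos_recursion_value_bound[OF assms, of z "- (pi / 2)"]
    unfolding R_def by linarith
qed

text \<open>Fubini with the first pivot innermost; the inner bound holds for almost all values of
  the other pivots.\<close>

lemma integral_recursion_value_bound:
  assumes \<tau>: "\<tau> > 0"
  shows "cmod (\<integral>u. iexp (\<tau> * recursion_value K z u) \<partial>uniforms K) \<le> piece_bound / sqrt \<tau>"
proof -
  let ?U = "uniform_measure lborel {0..1::real}"
  let ?P = "\<Pi>\<^sub>M i\<in>{2..K}. ?U"
  interpret U: prob_space "uniforms K" by (rule prob_space_uniforms)
  interpret P: prob_space ?P by (intro prob_space_PiM prob_space_unit)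
  interpret PS: product_sigma_finite "\<lambda>_::nat. ?U"
    by (simp add: product_sigma_finite_def uniform_unit.sigma_finite_measure_axioms)
  have ins: "{1..K} = insert 1 {2..K}" using K by auto
  have int: "integrable (uniforms K) (\<lambda>u. iexp (\<tau> * recursion_value K z u))"
    using measurable_recursion_value_snd[of z]
    by (intro U.integrable_const_bound[where B = 1]) (simp, measurable)
  have eq: "(\<integral>u. iexp (\<tau> * recursion_value K z u) \<partial>uniforms K) =
      (\<integral>x. (\<integral>y. iexp (\<tau> * recursion_value K z (x(1 := y))) \<partial>?U) \<partial>?P)"
    using int unfolding uniforms_def ins by (intro PS.product_integral_insert) auto
  have bound: "AE x in ?P. cmod (\<integral>y. iexp (\<tau> * recursion_value K z (x(1 := y))) \<partial>?U) \<le> piece_bound / sqrt \<tau>"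
  proof -
    have "AE x in uniform_measure lborel {0..1}. x \<in> {0..1::real}"
      by (rule AE_uniform_measureI) auto
    then have "AE x in ?P. \<forall>i\<in>{2..K}. x i \<in> {0..1}"
      by (intro AE_finite_allI AE_PiM_component prob_space_unit) auto
    then show ?thesis using AE_space
      by eventually_elim (intro iexp_recursion_value_bound \<tau>, auto)
  qed
  have pb: "0 \<le> piece_bound / sqrt \<tau>"
    using \<tau> \<alpha>_pos[OF K] by (simp add: piece_bound_def)
  show ?thesis
  proof (cases "integrable ?P (\<lambda>x. \<integral>y. iexp (\<tau> * recursion_value K z (x(1 := y))) \<partial>?U)")
    case True
    have "cmod (\<integral>u. iexp (\<tau> * recursion_value K z u) \<partial>uniforms K) \<le>
      (\<integral>x. cmod (\<integral>y. iexp (\<tau> * recursion_value K z (x(1 := y))) \<partial>?U) \<partial>?P)"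
      unfolding eq by (rule integral_norm_bound)
    also have "\<dots> \<le> (\<integral>x. piece_bound / sqrt \<tau> \<partial>?P)"
      using True bound by (intro integral_mono_AE integrable_norm) auto
    finally show ?thesis by (simp add: P.prob_space)
  next
    \<comment> \<open>A non-integrable function has Bochner integral 0, so the nonnegativity of the
      bound suffices.\<close>
    case False
    then show ?thesis unfolding eq using pb by (simp add: not_integrable_integral_eq)
  qed
qed

section \<open>Two bounds for the characteristic function from the recursion\<close>

context
  fixes \<mu> :: "real measure"
  assumes law: "quicksort_limit_law K \<mu>"
begin

lemma real_distribution_law: "real_distribution \<mu>"
  using law by (simp add: quicksort_limit_law_def)

interpretation M: real_distribution \<mu> by (rule real_distribution_law)

interpretation Z: prob_space "\<Pi>\<^sub>M i\<in>{0..K}. \<mu>"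
  by (intro prob_space_PiM M.prob_space_axioms)

interpretation U: prob_space "uniforms K" by (rule prob_space_uniforms)

interpretation ZU: pair_prob_space "\<Pi>\<^sub>M i\<in>{0..K}. \<mu>" "uniforms K" ..

lemma sets_law: "sets \<mu> = sets borel" by simp

lemma law_eq:
  "\<mu> = distr ((\<Pi>\<^sub>M i\<in>{0..K}. \<mu>) \<Otimes>\<^sub>M uniforms K) borel (\<lambda>(z, u). recursion_value K z u)"
proof -
  have "\<mu> = recursion_law K \<mu>" using law by (simp add: quicksort_limit_law_def)
  also have "\<dots> = distr ((\<Pi>\<^sub>M i\<in>{0..K}. \<mu>) \<Otimes>\<^sub>M uniforms K) borel (\<lambda>(z, u). recursion_value K z u)"
    unfolding recursion_law_def
    by (simp add: recursion_value_def toll_def sum.distrib add.assoc)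
  finally show ?thesis .
qed

lemma char_law_eq:
  "char \<mu> t = (\<integral>p. iexp (t * (case p of (z, u) \<Rightarrow> recursion_value K z u)) \<partial>((\<Pi>\<^sub>M i\<in>{0..K}. \<mu>) \<Otimes>\<^sub>M uniforms K))"
  unfolding char_def
  by (subst law_eq, subst integral_distr[OF measurable_recursion_value[OF sets_law]]) simp_all

lemma integrable_iexp_recursion_value:
  "integrable ((\<Pi>\<^sub>M i\<in>{0..K}. \<mu>) \<Otimes>\<^sub>M uniforms K) (\<lambda>(z, u). iexp (t * recursion_value K z u))"
proof -
  note [measurable] = measurable_recursion_value[OF sets_law]
  have "integrable ((\<Pi>\<^sub>M i\<in>{0..K}. \<mu>) \<Otimes>\<^sub>M uniforms K)
      (\<lambda>p. iexp (t * (case p of (z, u) \<Rightarrow> recursion_value K z u)))"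
    by (rule ZU.P.integrable_const_bound[where B = 1]) (simp, measurable)
  then show ?thesis by (simp add: case_prod_beta')
qed

text \<open>Fubini with the pivots innermost: the bound on the inner integral does not depend on the
  copies.\<close>

lemma cmod_char_le_sqrt:
  assumes "t > 0"
  shows "cmod (char \<mu> t) \<le> piece_bound / sqrt t"
proof -
  have "char \<mu> t = (\<integral>z. (\<integral>u. iexp (t * recursion_value K z u) \<partial>uniforms K) \<partial>(\<Pi>\<^sub>M i\<in>{0..K}. \<mu>))"
    unfolding char_law_eq
    by (subst ZU.integral_fst[OF integrable_iexp_recursion_value]) (simp add: case_prod_beta')
  then have "cmod (char \<mu> t) \<le>
      (\<integral>z. cmod (\<integral>u. iexp (t * recursion_value K z u) \<partial>uniforms K) \<partial>(\<Pi>\<^sub>M i\<in>{0..K}. \<mu>))"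
    by (simp add: integral_norm_bound)
  also have "\<dots> \<le> (\<integral>z. piece_bound / sqrt t \<partial>(\<Pi>\<^sub>M i\<in>{0..K}. \<mu>))"
    by (intro integral_mono integrable_norm integral_recursion_value_bound assms
        ZU.integrable_fst[OF integrable_iexp_recursion_value]) auto
  finally show ?thesis by (simp add: Z.prob_space)
qed

text \<open>Fubini in the opposite order: for fixed pivots the copies are independent, so the inner
  integral factorises, and the toll contributes a factor of modulus 1.\<close>

lemma cmod_char_le_prod:
  "cmod (char \<mu> t) \<le> (\<integral>u. (\<Prod>i=0..K. cmod (char \<mu> (t * spacing K u i))) \<partial>uniforms K)"
proof -
  interpret PS: product_sigma_finite "\<lambda>_::nat. \<mu>"
    by (simp add: product_sigma_finite_def M.sigma_finite_measure_axioms)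
  have inner: "(\<integral>z. iexp (t * recursion_value K z u) \<partial>(\<Pi>\<^sub>M i\<in>{0..K}. \<mu>)) =
      iexp (t * toll K u) * (\<Prod>i=0..K. char \<mu> (t * spacing K u i))" for u
  proof -
    have "iexp (t * recursion_value K z u) =
        iexp (t * toll K u) * (\<Prod>i=0..K. iexp (t * spacing K u i * z i))" for z
      unfolding recursion_value_def
      by (simp add: exp_sum[symmetric] exp_add[symmetric] sum_distrib_left algebra_simps)
    then have "(\<integral>z. iexp (t * recursion_value K z u) \<partial>(\<Pi>\<^sub>M i\<in>{0..K}. \<mu>)) =
        iexp (t * toll K u) * (\<integral>z. (\<Prod>i=0..K. iexp (t * spacing K u i * z i)) \<partial>(\<Pi>\<^sub>M i\<in>{0..K}. \<mu>))"
      by simp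
    also have "(\<integral>z. (\<Prod>i=0..K. iexp (t * spacing K u i * z i)) \<partial>(\<Pi>\<^sub>M i\<in>{0..K}. \<mu>)) =
        (\<Prod>i=0..K. \<integral>y. iexp (t * spacing K u i * y) \<partial>\<mu>)"
      by (rule PS.product_integral_prod) (auto intro!: M.integrable_iexp)
    finally show ?thesis by (simp add: char_def)
  qed
  have "char \<mu> t = (\<integral>u. (\<integral>z. iexp (t * recursion_value K z u) \<partial>(\<Pi>\<^sub>M i\<in>{0..K}. \<mu>)) \<partial>uniforms K)"
    unfolding char_law_eq
    by (subst ZU.integral_snd[OF integrable_iexp_recursion_value]) (simp add: case_prod_beta')
  then have "cmod (char \<mu> t) \<le>
      (\<integral>u. cmod (\<integral>z. iexp (t * recursion_value K z u) \<partial>(\<Pi>\<^sub>M i\<in>{0..K}. \<mu>)) \<partial>uniforms K)"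
    by (simp only: integral_norm_bound)
  then show ?thesis unfolding inner by (simp add: norm_mult prod_norm)
qed

end

end

section \<open>Decay of the characteristic function\<close>

lemma prod_le_two_factors:
  fixes f :: "nat \<Rightarrow> real"
  assumes "finite A" "i \<in> A" "j \<in> A" "i \<noteq> j" and f: "\<And>k. k \<in> A \<Longrightarrow> 0 \<le> f k \<and> f k \<le> 1"
  shows "prod f A \<le> f i * f j"
proof -
  have "prod f A = prod f (A - {i, j}) * prod f {i, j}"
    using assms by (intro prod.subset_diff) auto
  also have "\<dots> \<le> 1 * prod f {i, j}"
    using f assms by (intro mult_right_mono prod_le_1 prod_nonneg) auto
  finally show ?thesis using \<open>i \<noteq> j\<close> by simp
qed

context
  fixes K :: nat and \<mu> :: "real measure"
  assumes K: "K \<ge> 1" and law: "quicksort_limit_law K \<mu>"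
begin

interpretation M: real_distribution \<mu> by (rule real_distribution_law[OF K law])

interpretation U: prob_space "uniforms K" by (rule prob_space_uniforms)

text \<open>Some spacing is at least \<open>1 / (K + 1)\<close>, and one of the outer spacings is a different one; the
  latter is at least \<open>t powr (- 1 / 3)\<close> outside an event of probability \<open>O(t powr (- 1 / 3))\<close>.\<close>

lemma char_decay_step:
  assumes a: "a \<ge> 1 / 2" and C: "\<And>t. t > 0 \<Longrightarrow> cmod (char \<mu> t) \<le> C * t powr (- a)"
  shows "\<exists>C'. \<forall>t>0. cmod (char \<mu> t) \<le> C' * t powr (- (a + 1 / 3))"
proof -
  have C0: "0 \<le> C" using order_trans[OF norm_ge_zero C[of 1]] by simp
  \<comment> \<open>The factor (K + 1) powr a is the price of a largest spacing that is only known
    to be at least 1 / (K + 1).\<close>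
  define A where "A = C * (real K + 1) powr a"
  have A: "0 \<le> A" using C0 by (simp add: A_def)
  \<comment> \<open>The entry 1 covers t \<le> 1, where the power of t is at least 1 and the trivial
    bound suffices.\<close>
  define C' where "C' = max 1 (A * (2 * real K + C))"
  have "cmod (char \<mu> t) \<le> C' * t powr (- (a + 1 / 3))" if t: "t > 0" for t
  proof (cases "t \<le> 1")
    case True
    have "cmod (char \<mu> t) \<le> 1" by (rule M.cmod_char_le_1)
    also have "1 \<le> t powr (- (a + 1 / 3))"
      using powr_mono'[of "- (a + 1/3)" 0 t] True t a by simp
    also have "\<dots> \<le> C' * t powr (- (a + 1 / 3))"
      using mult_right_mono[of 1 C' "t powr (- (a + 1 / 3))"] by (simp add: C'_def)
    finally show ?thesis .
  next
    case False
    \<comment> \<open>The bad event has probability O(e), and off it the second factor is at most C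
      * (t * e) powr (- a) = C * t powr (- 2 * a / 3), which is at most C * e because a \<ge> 1 /
      2.\<close>
    define e where "e = t powr (- 1 / 3)"
    have e: "0 < e" using t by (simp add: e_def)
    define B where "B = {u \<in> space (uniforms K). spacing K u 0 < e \<or> spacing K u K < e}"
    have B: "B \<in> sets (uniforms K)" unfolding B_def using K by measurable
    have PB: "measure (uniforms K) B \<le> 2 * real K * e"
      unfolding B_def using e by (intro prob_small_first_or_last_spacing K) auto
    have le: "(\<Prod>i=0..K. cmod (char \<mu> (t * spacing K u i))) \<le> A * t powr (- a) * (indicator B u + C * e)"
      if u: "u \<in> unit_points K" "u \<in> space (uniforms K)" for u
    proof -
      obtain i where i: "i \<le> K" "1 / (real K + 1) \<le> spacing K u i"
        using large_spacing_exists[OF K] by blast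
      define j where "j = (if i = 0 then K else 0)"
      have j: "j \<le> K" "i \<noteq> j" using K by (auto simp: j_def)
      have "(\<Prod>i=0..K. cmod (char \<mu> (t * spacing K u i))) \<le>
          cmod (char \<mu> (t * spacing K u i)) * cmod (char \<mu> (t * spacing K u j))"
        using i j M.cmod_char_le_1 by (intro prod_le_two_factors) auto
      also have "\<dots> \<le> (A * t powr (- a)) * (indicator B u + C * e)"
      proof (intro mult_mono)
        have pos: "0 < t / (real K + 1)" using t by simp
        have "t / (real K + 1) \<le> t * spacing K u i"
          using mult_left_mono[OF i(2), of t] t by simp
        then have "cmod (char \<mu> (t * spacing K u i)) \<le> C * (t * spacing K u i) powr (- a)"
          using pos by (intro C) linarith
        also have "\<dots> \<le> C * (t / (real K + 1)) powr (- a)"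
          using C0 a pos \<open>t / (real K + 1) \<le> t * spacing K u i\<close>
          by (intro mult_left_mono powr_mono2') auto
        also have "\<dots> = A * t powr (- a)"
          using t by (simp add: A_def powr_divide powr_minus_divide)
        finally show "cmod (char \<mu> (t * spacing K u i)) \<le> A * t powr (- a)" .
        show "cmod (char \<mu> (t * spacing K u j)) \<le> indicator B u + C * e"
        proof (cases "u \<in> B")
          case True
          have "cmod (char \<mu> (t * spacing K u j)) \<le> 1" by (rule M.cmod_char_le_1)
          then show ?thesis using True C0 e by (simp add: add_increasing2)
        next
          case False
          then have ej: "e \<le> spacing K u j" using u by (auto simp: B_def j_def)
          then have le: "t * e \<le> t * spacing K u j" using t by simp
          have pos: "0 < t * e" using t e by simp
          have "cmod (char \<mu> (t * spacing K u j)) \<le> C * (t * spacing K u j) powr (- a)"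
            using pos le by (intro C) linarith
          also have "\<dots> \<le> C * (t * e) powr (- a)"
            using C0 a pos le t ej by (intro mult_left_mono powr_mono2') auto
          also have "(t * e) powr (- a) = t powr ((2 / 3) * (- a))"
          proof -
            have "t * e = t powr 1 * t powr (- 1 / 3)" using t by (simp add: e_def)
            also have "\<dots> = t powr (2 / 3)" by (simp only: powr_add[symmetric]) simp
            finally show ?thesis by (simp add: powr_powr)
          qed
          also have "C * t powr ((2 / 3) * (- a)) \<le> C * e"
            using C0 a \<open>\<not> t \<le> 1\<close> unfolding e_def by (intro mult_left_mono powr_mono) auto
          finally show ?thesis using False by simp
        qed
      qed (use A in auto)
      finally show ?thesis .
    qed
    have "cmod (char \<mu> t) \<le> (\<integral>u. (\<Prod>i=0..K. cmod (char \<mu> (t * spacing K u i))) \<partial>uniforms K)"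
      by (rule cmod_char_le_prod[OF K law])
    also have "\<dots> \<le> (\<integral>u. A * t powr (- a) * (indicator B u + C * e) \<partial>uniforms K)"
    proof (rule integral_mono_AE)
      have char_meas: "(\<lambda>u. char \<mu> (t * spacing K u i)) \<in> borel_measurable (uniforms K)" for i
        by (rule measurable_compose[OF _ M.char_measurable]) (use K in measurable)
      have meas: "(\<lambda>u. \<Prod>i=0..K. cmod (char \<mu> (t * spacing K u i))) \<in> borel_measurable (uniforms K)"
        by (intro borel_measurable_prod measurable_compose[OF char_meas borel_measurable_norm])
      show "integrable (uniforms K) (\<lambda>u. \<Prod>i=0..K. cmod (char \<mu> (t * spacing K u i)))"
        by (rule U.integrable_const_bound[where B = 1])
           (use meas M.cmod_char_le_1 in \<open>auto intro!: prod_le_1 simp: abs_of_nonneg prod_nonneg\<close>)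
      show "AE u in uniforms K. (\<Prod>i=0..K. cmod (char \<mu> (t * spacing K u i))) \<le>
          A * t powr (- a) * (indicator B u + C * e)"
        using AE_unit_points AE_space by eventually_elim (rule le)
    qed (use B in \<open>auto simp: U.emeasure_eq_measure\<close>)
    also have "\<dots> = A * t powr (- a) * (measure (uniforms K) B + C * e)"
      using B by (simp add: U.prob_space U.emeasure_eq_measure)
    also have "\<dots> \<le> A * t powr (- a) * (2 * real K * e + C * e)"
      using PB A by (intro mult_left_mono) auto
    also have "\<dots> = A * (2 * real K + C) * (t powr (- a) * e)" by (simp add: algebra_simps)
    also have "t powr (- a) * e = t powr (- (a + 1 / 3))"
      unfolding e_def powr_add[symmetric] by simp
    also have "A * (2 * real K + C) * t powr (- (a + 1 / 3)) \<le> C' * t powr (- (a + 1 / 3))"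
      by (intro mult_right_mono) (auto simp: C'_def)
    finally show ?thesis .
  qed
  then show ?thesis by blast
qed

lemma char_decay_powr:
  "\<exists>C. \<forall>t>0. cmod (char \<mu> t) \<le> C * t powr (- (1 / 2 + real n / 3))"
proof (induction n)
  case 0
  have "cmod (char \<mu> t) \<le> piece_bound K * t powr (- (1 / 2))" if "t > 0" for t
    using cmod_char_le_sqrt[OF K law that] that
    by (simp add: powr_minus_divide powr_half_sqrt)
  then show ?case by auto
next
  case (Suc n)
  then obtain C where "\<And>t. t > 0 \<Longrightarrow> cmod (char \<mu> t) \<le> C * t powr (- (1 / 2 + real n / 3))" by blast
  from char_decay_step[OF _ this] show ?case by (simp add: add_divide_distrib add.assoc add.commute)
qed

lemma cmod_char_minus: "cmod (char \<mu> (- t)) = cmod (char \<mu> t)"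
proof -
  have "char \<mu> (- t) = cnj (char \<mu> t)"
  proof -
    have "char \<mu> (- t) = (\<integral>x. cnj (iexp (t * x)) \<partial>\<mu>)"
      unfolding char_def by (simp add: exp_cnj)
    also have "\<dots> = cnj (char \<mu> t)" unfolding char_def by (rule Bochner_Integration.integral_cnj)
    finally show ?thesis .
  qed
  then show ?thesis by simp
qed

lemma char_decay: "\<exists>C. \<forall>t. \<bar>t\<bar> ^ n * cmod (char \<mu> t) \<le> C"
proof -
  \<comment> \<open>After 3 * n gains of 1 / 3 the exponent is n + 1 / 2.\<close>
  obtain C where C: "\<And>t. t > 0 \<Longrightarrow> cmod (char \<mu> t) \<le> C * t powr (- (1 / 2 + real (3 * n) / 3))"
    using char_decay_powr by blast
  have "\<bar>t\<bar> ^ n * cmod (char \<mu> t) \<le> max 1 C" for t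
  proof (cases "\<bar>t\<bar> \<le> 1")
    case True
    then have "\<bar>t\<bar> ^ n * cmod (char \<mu> t) \<le> 1 * 1"
      by (intro mult_mono M.cmod_char_le_1 power_le_one) auto
    then show ?thesis by simp
  next
    case False
    then have t: "\<bar>t\<bar> > 1" by simp
    have C0: "0 \<le> C" using order_trans[OF norm_ge_zero C[of 1]] by simp
    have "cmod (char \<mu> t) = cmod (char \<mu> \<bar>t\<bar>)" using cmod_char_minus[of t] by (auto simp: abs_if)
    also have "\<dots> \<le> C * \<bar>t\<bar> powr (- (1 / 2 + real (3 * n) / 3))" using t by (intro C) simp
    also have "\<dots> \<le> C * \<bar>t\<bar> powr (- real n)"
      using t C0 by (intro mult_left_mono powr_mono) auto
    finally have "\<bar>t\<bar> ^ n * cmod (char \<mu> t) \<le> \<bar>t\<bar> ^ n * (C * \<bar>t\<bar> powr (- real n))"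
      by (intro mult_left_mono) auto
    also have "\<dots> = C" using t by (simp add: powr_minus powr_realpow)
    finally show ?thesis by simp
  qed
  then show ?thesis by blast
qed

end

section \<open>Densities by Fourier inversion\<close>

text \<open>A global quadratic remainder identifies the derivative. In this form the Fourier
  integrals are differentiated without a theorem on differentiation under the integral sign.\<close>

lemma has_real_derivative_quadratic:
  fixes g :: "real \<Rightarrow> real"
  assumes "\<And>y. \<bar>g y - g x - (y - x) * d\<bar> \<le> C * (y - x)\<^sup>2"
  shows "(g has_real_derivative d) (at x)"
proof -
  have "((\<lambda>y. C * \<bar>y - x\<bar>) \<longlongrightarrow> C * \<bar>x - x\<bar>) (at x)"
    by (rule tendsto_mult[OF tendsto_const tendsto_rabs[OF tendsto_diff[OF tendsto_ident_at tendsto_const]]])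
  then have lim: "((\<lambda>y. C * \<bar>y - x\<bar>) \<longlongrightarrow> 0) (at x)" by simp
  have "norm ((g y - g x) / (y - x) - d) \<le> C * \<bar>y - x\<bar>" if "y \<noteq> x" for y
  proof -
    have "(g y - g x) / (y - x) - d = (g y - g x - (y - x) * d) / (y - x)"
      using that by (simp add: diff_divide_distrib)
    then have "norm ((g y - g x) / (y - x) - d) = \<bar>g y - g x - (y - x) * d\<bar> / \<bar>y - x\<bar>" by simp
    also have "\<dots> \<le> C * (y - x)\<^sup>2 / \<bar>y - x\<bar>"
      by (rule divide_right_mono[OF assms abs_ge_zero])
    also have "\<dots> = C * \<bar>y - x\<bar>"
    proof -
      have "(y - x)\<^sup>2 / \<bar>y - x\<bar> = \<bar>y - x\<bar>"
        using that by (simp add: divide_eq_eq power2_eq_square)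
      then show ?thesis by (simp only: times_divide_eq_right[symmetric])
    qed
    finally show ?thesis .
  qed
  then have "((\<lambda>y. (g y - g x) / (y - x) - d) \<longlongrightarrow> 0) (at x)"
    by (intro Lim_null_comparison[OF _ lim]) (simp add: eventually_at_filter)
  then show ?thesis unfolding has_field_derivative_iff by (rule LIM_zero_cancel)
qed

lemma iexp_second_order: "cmod (iexp x - 1 - \<i> * x) \<le> x\<^sup>2 / 2"
  using iexp_approx1[of x 1] by (simp add: power2_eq_square algebra_simps)

lemma integrable_inverse_1_plus_square_lborel:
  "integrable lborel (\<lambda>x::real. inverse (1 + x\<^sup>2))"
  using integrable_inverse_1_plus_square by (simp add: set_integrable_def)

context
  fixes M :: "real measure"
  assumes M: "real_distribution M"
    and decay: "\<And>n. \<exists>C. \<forall>t. \<bar>t\<bar> ^ n * cmod (char M t) \<le> C"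
begin

interpretation real_distribution M by (rule M)

text \<open>The decay bounds for the powers n and n + 2 add up to domination by a multiple of 1 / (1
  + t^2).\<close>

lemma integrable_power_char: "integrable lborel (\<lambda>t. \<bar>t\<bar> ^ n * cmod (char M t))"
proof -
  obtain C where C: "\<And>t. \<bar>t\<bar> ^ n * cmod (char M t) \<le> C" using decay[of n] by auto
  obtain C' where C': "\<And>t. \<bar>t\<bar> ^ (n + 2) * cmod (char M t) \<le> C'" using decay[of "n+2"] by auto
  show ?thesis
  proof (rule Bochner_Integration.integrable_bound)
    show "integrable lborel (\<lambda>t. (C + C') * inverse (1 + t\<^sup>2))"
      by (intro integrable_mult_right integrable_inverse_1_plus_square_lborel)
    show "AE t in lborel. norm (\<bar>t\<bar> ^ n * cmod (char M t)) \<le> norm ((C + C') * inverse (1 + t\<^sup>2))"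
    proof (rule AE_I2)
      fix t :: real
      have pos: "0 < 1 + t\<^sup>2" by (simp add: add_pos_nonneg)
      have "\<bar>t\<bar> ^ n * cmod (char M t) * (1 + t\<^sup>2) =
          \<bar>t\<bar> ^ n * cmod (char M t) + \<bar>t\<bar> ^ (n + 2) * cmod (char M t)"
        by (simp add: algebra_simps power_add power2_eq_square)
      also have "\<dots> \<le> C + C'" using C[of t] C'[of t] by linarith
      finally have "\<bar>t\<bar> ^ n * cmod (char M t) \<le> (C + C') * inverse (1 + t\<^sup>2)"
        unfolding divide_inverse[symmetric] pos_le_divide_eq[OF pos] .
      then have "\<bar>t\<bar> ^ n * cmod (char M t) \<le> norm ((C + C') * inverse (1 + t\<^sup>2))"
        by (rule order_trans) (simp only: real_norm_def abs_ge_self)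
      then show "norm (\<bar>t\<bar> ^ n * cmod (char M t)) \<le> norm ((C + C') * inverse (1 + t\<^sup>2))"
        by (subst real_norm_def, subst abs_of_nonneg) auto
    qed
  qed measurable
qed

definition fourier_integrand :: "nat \<Rightarrow> real \<Rightarrow> real \<Rightarrow> complex" where
  "fourier_integrand k x t = (- \<i> * t) ^ k * iexp (- (t * x)) * char M t"

text \<open>The Fourier inversion formula for the density, differentiated \<open>k\<close> times
  under the integral sign. Taking real parts yields a real function at once.\<close>

definition density_derivative :: "nat \<Rightarrow> real \<Rightarrow> real" where
  "density_derivative k x = Re (\<integral>t. fourier_integrand k x t \<partial>lborel) / (2 * pi)"

definition abs_moment :: "nat \<Rightarrow> real" where
  "abs_moment k = (\<integral>t. \<bar>t\<bar> ^ k * cmod (char M t) \<partial>lborel)"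

lemma measurable_fourier_integrand [measurable]: "fourier_integrand k x \<in> borel_measurable borel"
  unfolding fourier_integrand_def[abs_def] by measurable

lemma cmod_fourier_integrand: "cmod (fourier_integrand k x t) = \<bar>t\<bar> ^ k * cmod (char M t)"
  by (simp add: fourier_integrand_def norm_mult norm_power)

lemma integrable_fourier_integrand: "integrable lborel (fourier_integrand k x)"
  by (rule Bochner_Integration.integrable_bound[OF integrable_power_char[of k]])
     (auto simp: cmod_fourier_integrand)

lemma abs_density_derivative_le: "\<bar>density_derivative k x\<bar> \<le> abs_moment k / (2 * pi)"
proof -
  have "\<bar>Re (\<integral>t. fourier_integrand k x t \<partial>lborel)\<bar> \<le> cmod (\<integral>t. fourier_integrand k x t \<partial>lborel)"
    by (rule abs_Re_le_cmod)
  also have "\<dots> \<le> (\<integral>t. cmod (fourier_integrand k x t) \<partial>lborel)" by (rule integral_norm_bound)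
  finally show ?thesis
    by (simp add: density_derivative_def abs_moment_def cmod_fourier_integrand divide_right_mono)
qed

text \<open>The second order Taylor remainder of the exponential costs two further powers of t,
  which the decay of the characteristic function absorbs.\<close>

lemma DERIV_density_derivative:
  "(density_derivative k has_real_derivative density_derivative (Suc k) x) (at x)"
proof (rule has_real_derivative_quadratic[where C = "abs_moment (k + 2) / 2 / (2 * pi)"])
  fix y
  let ?D = "\<lambda>t. fourier_integrand k y t - fourier_integrand k x t - (y - x) * fourier_integrand (Suc k) x t"
  have eq: "density_derivative k y - density_derivative k x - (y - x) * density_derivative (Suc k) x =
      Re (\<integral>t. ?D t \<partial>lborel) / (2 * pi)"
    unfolding density_derivative_def
    by (simp add: integrable_fourier_integrand diff_divide_distrib)
  have D: "cmod (?D t) \<le> (y - x)\<^sup>2 / 2 * (\<bar>t\<bar> ^ (k + 2) * cmod (char M t))" for t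
  proof -
    have ex: "iexp (- (t * y)) = iexp (- (t * x)) * iexp (- (t * (y - x)))"
      by (simp add: exp_add[symmetric] algebra_simps)
    have "?D t = (- \<i> * t) ^ k * iexp (- (t * x)) * char M t *
        (iexp (- (t * (y - x))) - 1 - \<i> * complex_of_real (- (t * (y - x))))"
      unfolding fourier_integrand_def ex by (simp add: algebra_simps)
    then have "cmod (?D t) = \<bar>t\<bar> ^ k * cmod (char M t) *
        cmod (iexp (- (t * (y - x))) - 1 - \<i> * complex_of_real (- (t * (y - x))))"
      by (simp only: norm_mult norm_power norm_exp_i_times) simp
    also have "\<dots> \<le> \<bar>t\<bar> ^ k * cmod (char M t) * ((- (t * (y - x)))\<^sup>2 / 2)"
      by (intro mult_left_mono iexp_second_order) auto
    also have "\<dots> = (y - x)\<^sup>2 / 2 * (\<bar>t\<bar> ^ (k + 2) * cmod (char M t))"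
      by (simp add: power_mult_distrib power_add power2_eq_square)
    finally show ?thesis .
  qed
  have "\<bar>Re (\<integral>t. ?D t \<partial>lborel)\<bar> \<le> cmod (\<integral>t. ?D t \<partial>lborel)" by (rule abs_Re_le_cmod)
  also have "\<dots> \<le> (\<integral>t. cmod (?D t) \<partial>lborel)" by (rule integral_norm_bound)
  also have "\<dots> \<le> (\<integral>t. (y - x)\<^sup>2 / 2 * (\<bar>t\<bar> ^ (k + 2) * cmod (char M t)) \<partial>lborel)"
    by (intro integral_mono D integrable_norm Bochner_Integration.integrable_diff
        integrable_mult_right integrable_fourier_integrand integrable_power_char)
  also have "\<dots> = abs_moment (k + 2) / 2 * (y - x)\<^sup>2"
    by (simp add: abs_moment_def)
  finally show "\<bar>density_derivative k y - density_derivative k x - (y - x) * density_derivative (Suc k) x\<bar>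
      \<le> abs_moment (k + 2) / 2 / (2 * pi) * (y - x)\<^sup>2"
    unfolding eq by (simp add: field_simps)
qed

text \<open>The integrand of Levy's inversion formula for the mass of the interval from
  \<open>a\<close> to \<open>b\<close>. At t = 0 division by zero gives 0 instead of the removable
  value, on a null set.\<close>

definition levy_integrand :: "real \<Rightarrow> real \<Rightarrow> real \<Rightarrow> complex" where
  "levy_integrand a b t = (iexp (- (t * a)) - iexp (- (t * b))) / (\<i> * t) * char M t"

definition levy_increment :: "real \<Rightarrow> real \<Rightarrow> real" where
  "levy_increment a b = Re (\<integral>t. levy_integrand a b t \<partial>lborel) / (2 * pi)"

lemma measurable_levy_integrand [measurable]: "levy_integrand a b \<in> borel_measurable borel"
  unfolding levy_integrand_def[abs_def] by measurable

text \<open>The same Taylor remainder, divided by t, compares the mass of an interval with its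
  length times the candidate density at \<open>a\<close>.\<close>

lemma levy_integrand_approx:
  assumes "t \<noteq> 0"
  shows "cmod (levy_integrand a b t - (b - a) * fourier_integrand 0 a t)
    \<le> (b - a)\<^sup>2 / 2 * (\<bar>t\<bar> * cmod (char M t))"
proof -
  have ex: "iexp (- (t * b)) = iexp (- (t * a)) * iexp (- (t * (b - a)))"
    by (simp add: exp_add[symmetric] algebra_simps)
  have "levy_integrand a b t - (b - a) * fourier_integrand 0 a t =
      - (iexp (- (t * a)) * (iexp (- (t * (b - a))) - 1 - \<i> * complex_of_real (- (t * (b - a)))) / (\<i> * t) * char M t)"
  proof -
    have "(E - E * F) / (\<i> * s) * \<phi> - c * (E * \<phi>) = - (E * (F - 1 - \<i> * (- (s * c))) / (\<i> * s) * \<phi>)"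
      if "s \<noteq> 0" for E F \<phi> c s :: complex
      using that by (simp add: field_simps)
    from this[of "complex_of_real t" "iexp (- (t * a))" "iexp (- (t * (b - a)))" "char M t" "complex_of_real (b - a)"]
    show ?thesis
      unfolding levy_integrand_def fourier_integrand_def ex using assms by simp
  qed
  then have "cmod (levy_integrand a b t - (b - a) * fourier_integrand 0 a t) =
      cmod (iexp (- (t * (b - a))) - 1 - \<i> * complex_of_real (- (t * (b - a)))) / \<bar>t\<bar> * cmod (char M t)"
    by (simp only: norm_mult norm_divide norm_minus_cancel norm_exp_i_times) simp
  also have "\<dots> \<le> (- (t * (b - a)))\<^sup>2 / 2 / \<bar>t\<bar> * cmod (char M t)"
    by (intro mult_right_mono divide_right_mono iexp_second_order) auto
  also have "(- (t * (b - a)))\<^sup>2 / 2 / \<bar>t\<bar> = (b - a)\<^sup>2 / 2 * \<bar>t\<bar>"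
  proof -
    have "t * t / \<bar>t\<bar> = \<bar>t\<bar>" using assms by (simp add: divide_eq_eq)
    moreover have "(- (t * c))\<^sup>2 / 2 / r = c\<^sup>2 / 2 * (t * t / r)" for c r :: real
      by (simp add: power2_eq_square)
    ultimately show ?thesis by (simp only:)
  qed
  finally show ?thesis by simp
qed

lemma uncountable_nonempty: "uncountable A \<Longrightarrow> A \<noteq> {}"
  by auto

lemma AE_nonzero: "AE t in lborel. t \<noteq> (0::real)"
  by (rule AE_lborel_singleton)

lemma integrable_levy_integrand: "integrable lborel (levy_integrand a b)"
proof -
  have "integrable lborel (\<lambda>t. levy_integrand a b t - (b - a) * fourier_integrand 0 a t)"
  proof (rule Bochner_Integration.integrable_bound)
    show "integrable lborel (\<lambda>t. (b - a)\<^sup>2 / 2 * (\<bar>t\<bar> ^ 1 * cmod (char M t)))"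
      by (intro integrable_mult_right integrable_power_char)
    show "AE t in lborel. cmod (levy_integrand a b t - (b - a) * fourier_integrand 0 a t)
        \<le> norm ((b - a)\<^sup>2 / 2 * (\<bar>t\<bar> ^ 1 * cmod (char M t)))"
      using AE_nonzero by eventually_elim (use levy_integrand_approx in simp)
  qed measurable
  from Bochner_Integration.integrable_add[OF this integrable_mult_right[OF integrable_fourier_integrand[of 0 a], of "b - a"]]
  show ?thesis by simp
qed

lemma levy_increment_approx:
  "\<bar>levy_increment a b - (b - a) * density_derivative 0 a\<bar> \<le> abs_moment 1 / 2 / (2 * pi) * (b - a)\<^sup>2"
proof -
  let ?D = "\<lambda>t. levy_integrand a b t - (b - a) * fourier_integrand 0 a t"
  have eq: "levy_increment a b - (b - a) * density_derivative 0 a = Re (\<integral>t. ?D t \<partial>lborel) / (2 * pi)"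
    unfolding levy_increment_def density_derivative_def
    by (simp add: integrable_fourier_integrand integrable_levy_integrand diff_divide_distrib)
  have "\<bar>Re (\<integral>t. ?D t \<partial>lborel)\<bar> \<le> cmod (\<integral>t. ?D t \<partial>lborel)" by (rule abs_Re_le_cmod)
  also have "\<dots> \<le> (\<integral>t. cmod (?D t) \<partial>lborel)" by (rule integral_norm_bound)
  also have "\<dots> \<le> (\<integral>t. (b - a)\<^sup>2 / 2 * (\<bar>t\<bar> ^ 1 * cmod (char M t)) \<partial>lborel)"
  proof (rule integral_mono_AE)
    show "AE t in lborel. cmod (?D t) \<le> (b - a)\<^sup>2 / 2 * (\<bar>t\<bar> ^ 1 * cmod (char M t))"
      using AE_nonzero by eventually_elim (use levy_integrand_approx in simp)
  qed (intro integrable_norm Bochner_Integration.integrable_diff integrable_mult_right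
      integrable_fourier_integrand integrable_power_char integrable_levy_integrand)+
  also have "\<dots> = abs_moment 1 / 2 * (b - a)\<^sup>2" by (simp add: abs_moment_def)
  finally show ?thesis unfolding eq by (simp add: field_simps)
qed

lemma levy_increment_swap: "levy_increment b a = - levy_increment a b"
proof -
  have "levy_integrand b a t = - levy_integrand a b t" for t
    by (simp add: levy_integrand_def diff_divide_distrib algebra_simps)
  then show ?thesis by (simp add: levy_increment_def)
qed

text \<open>Levy inversion is a limit of truncated integrals; as the integrand is integrable,
  dominated convergence identifies it with the integral over the whole line.\<close>

lemma measure_Ioc_no_atoms:
  assumes "a \<le> b" "measure M {a} = 0" "measure M {b} = 0"
  shows "measure M {a<..b} = levy_increment a b"
proof -
  have "(\<lambda>T::nat. \<integral>t. indicator (einterval (- real T) (real T)) t *\<^sub>R levy_integrand a b t \<partial>lborel)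
      \<longlonglongrightarrow> (\<integral>t. levy_integrand a b t \<partial>lborel)"
  proof (rule integral_dominated_convergence)
    show "integrable lborel (\<lambda>t. cmod (levy_integrand a b t))"
      by (intro integrable_norm integrable_levy_integrand)
    show "AE t in lborel. (\<lambda>T. indicator (einterval (- real T) (real T)) t *\<^sub>R levy_integrand a b t)
        \<longlonglongrightarrow> levy_integrand a b t"
    proof (rule AE_I2)
      fix t :: real
      obtain N :: nat where N: "\<bar>t\<bar> < real N" using reals_Archimedean2 by blast
      have "\<forall>\<^sub>F T in sequentially. indicator (einterval (- real T) (real T)) t *\<^sub>R levy_integrand a b t
          = levy_integrand a b t"
        using eventually_ge_at_top[of N]
        by eventually_elim (use N in \<open>auto simp: indicator_def einterval_def\<close>)
      then show "(\<lambda>T. indicator (einterval (- real T) (real T)) t *\<^sub>R levy_integrand a b t)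
        \<longlonglongrightarrow> levy_integrand a b t" by (rule tendsto_eventually)
    qed
  qed (auto simp: indicator_def)
  moreover have "(CLBINT t=- real T..real T. levy_integrand a b t) =
     (\<integral>t. indicator (einterval (- real T) (real T)) t *\<^sub>R levy_integrand a b t \<partial>lborel)" for T :: nat
    by (simp add: interval_lebesgue_integral_def set_lebesgue_integral_def)
  ultimately have "(\<lambda>T::nat. 1 / (2 * pi) * (CLBINT t=- real T..real T. levy_integrand a b t))
      \<longlonglongrightarrow> 1 / (2 * pi) * (\<integral>t. levy_integrand a b t \<partial>lborel)"
    by (intro tendsto_intros) simp
  moreover have "(\<lambda>T::nat. 1 / (2 * pi) * (CLBINT t=- real T..real T. levy_integrand a b t))
      \<longlonglongrightarrow> complex_of_real (measure M {a<..b})"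
    using Levy_Inversion[OF assms] by (simp add: levy_integrand_def)
  ultimately have "complex_of_real (measure M {a<..b}) = 1 / (2 * pi) * (\<integral>t. levy_integrand a b t \<partial>lborel)"
    by (rule LIMSEQ_unique[symmetric])
  then have "measure M {a<..b} = Re (1 / (2 * pi) * (\<integral>t. levy_integrand a b t \<partial>lborel))"
    by (metis Re_complex_of_real)
  then show ?thesis by (simp add: levy_increment_def)
qed

text \<open>Inversion requires endpoints that are not atoms. Atoms are countable, so such endpoints
  exist on both sides arbitrarily close to \<open>x\<close>, and the mass between them is at most
  proportional to their distance.\<close>

lemma no_atoms: "measure M {x} = 0"
proof (rule ccontr)
  assume neg: "measure M {x} \<noteq> 0"
  define C where "C = abs_moment 0 / (2 * pi) + abs_moment 1 / 2 / (2 * pi)"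
  have "abs_moment k \<ge> 0" for k unfolding abs_moment_def by (rule Bochner_Integration.integral_nonneg) simp
  then have C: "C \<ge> 0" by (simp add: C_def)
  \<comment> \<open>The interval around \<open>x\<close> has length at most 2 * h \<le> 1, so its
    squared length is at most its length and its mass at most 2 * h * C. The summand 1 in C + 1
    keeps the denominator positive.\<close>
  define h where "h = min (1/2) (measure M {x} / (4 * (C + 1)))"
  have mpos: "measure M {x} > 0" using neg measure_nonneg[of M "{x}"] by linarith
  have h: "0 < h" "h \<le> 1/2" 
    unfolding h_def using C mpos by (simp_all only: min.cobounded1) simp
  have hC: "2 * h * C < measure M {x}"
  proof -
    have "h * (4 * (C + 1)) \<le> measure M {x}"
      using C min.cobounded2[of "1/2" "measure M {x} / (4 * (C + 1))"] unfolding h_def[symmetric]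
      by (subst (asm) pos_le_divide_eq) auto
    moreover have "h * (4 * (C + 1)) = 4 * (h * C) + 4 * h" "2 * h * C = 2 * (h * C)"
      by (simp_all add: algebra_simps)
    moreover have "0 \<le> h * C" using h C by simp
    ultimately show ?thesis using h by linarith
  qed
  have "uncountable ({x - h<..<x} - {x. measure M {x} > 0})"
    using h by (intro uncountable_minus_countable countable_atoms) (simp add: uncountable_open_interval)
  from uncountable_nonempty[OF this] obtain a where a: "a \<in> {x - h<..<x}" "\<not> measure M {a} > 0" by blast
  have "uncountable ({x<..<x + h} - {x. measure M {x} > 0})"
    using h by (intro uncountable_minus_countable countable_atoms) (simp add: uncountable_open_interval)
  from uncountable_nonempty[OF this] obtain b where b: "b \<in> {x<..<x + h}" "\<not> measure M {b} > 0" by blast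
  have ab: "a \<le> b" "0 \<le> b - a" "b - a \<le> 2 * h" "b - a \<le> 1" using a b h by auto
  have "measure M {x} \<le> measure M {a<..b}" using a b by (intro finite_measure_mono) auto
  also have "\<dots> = levy_increment a b"
    using a b ab zero_less_measure_iff by (intro measure_Ioc_no_atoms) (auto simp: zero_less_measure_iff)
  also have "\<dots> \<le> (b - a) * density_derivative 0 a + abs_moment 1 / 2 / (2 * pi) * (b - a)\<^sup>2"
    using levy_increment_approx[of a b] by linarith
  also have "\<dots> \<le> (b - a) * (abs_moment 0 / (2 * pi)) + abs_moment 1 / 2 / (2 * pi) * (b - a)"
  proof (intro add_mono mult_left_mono)
    show "density_derivative 0 a \<le> abs_moment 0 / (2 * pi)"
      using abs_density_derivative_le[of 0 a] by linarith
    show "(b - a)\<^sup>2 \<le> b - a" using ab by (simp add: power2_eq_square mult_left_le)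
  qed (use ab \<open>\<And>k. abs_moment k \<ge> 0\<close> in auto)
  also have "\<dots> = (b - a) * C" by (simp add: C_def algebra_simps)
  also have "\<dots> \<le> 2 * h * C" using ab C by (intro mult_right_mono) auto
  finally show False using hC by simp
qed

lemma DERIV_cdf: "(cdf M has_real_derivative density_derivative 0 x) (at x)"
proof (rule has_real_derivative_quadratic)
  fix y
  have inc: "cdf M b - cdf M a = levy_increment a b" if "a \<le> b" for a b
  proof (cases "a = b")
    case True
    then show ?thesis using levy_increment_swap[of a a] by simp
  next
    case False
    then show ?thesis using that cdf_diff_eq[of a b] measure_Ioc_no_atoms[of a b] no_atoms by simp
  qed
  have "cdf M y - cdf M x = levy_increment x y"
  proof (cases "x \<le> y")
    case False
    then show ?thesis using inc[of y x] levy_increment_swap[of x y] by simp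
  qed (rule inc)
  then show "\<bar>cdf M y - cdf M x - (y - x) * density_derivative 0 x\<bar> \<le> abs_moment 1 / 2 / (2 * pi) * (y - x)\<^sup>2"
    using levy_increment_approx[of x y] by simp
qed

lemma density_nonneg: "0 \<le> density_derivative 0 x"
proof (rule ccontr)
  assume "\<not> ?thesis"
  then obtain d where "d > 0" "\<And>h. 0 < h \<Longrightarrow> h < d \<Longrightarrow> cdf M (x + h) < cdf M x"
    using DERIV_neg_dec_right[OF DERIV_cdf[of x]] by auto
  then have "cdf M (x + d / 2) < cdf M x" by simp
  moreover have "cdf M x \<le> cdf M (x + d / 2)" using \<open>d > 0\<close> by (intro cdf_nondecreasing) simp
  ultimately show False by simp
qed

lemma measurable_density_derivative [measurable]: "density_derivative k \<in> borel_measurable borel"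
  by (intro borel_measurable_continuous_onI continuous_at_imp_continuous_on ballI
      DERIV_isCont[OF DERIV_density_derivative])

text \<open>Both measures agree on all right half-lines, by the fundamental theorem of calculus for
  the distribution function and its limit 1 at infinity.\<close>

lemma law_eq_density: "M = density lborel (\<lambda>x. ennreal (density_derivative 0 x))"
proof (rule measure_eqI_lessThan)
  fix x :: real
  show "emeasure M {x<..} < \<infinity>" by (simp add: emeasure_eq_measure)
  have "emeasure (density lborel (\<lambda>x. ennreal (density_derivative 0 x))) {x<..} =
      (\<integral>\<^sup>+y. ennreal (density_derivative 0 y) * indicator {x<..} y \<partial>lborel)"
    by (rule emeasure_density) auto
  also have "\<dots> = (\<integral>\<^sup>+y. ennreal (density_derivative 0 y) * indicator {x..} y \<partial>lborel)"
    using AE_lborel_singleton[of x]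
    by (intro nn_integral_cong_AE) (auto elim!: eventually_mono simp: indicator_def)
  also have "\<dots> = ennreal (1 - cdf M x)"
    by (rule nn_integral_FTC_atLeast) (auto intro: DERIV_cdf density_nonneg cdf_lim_at_top_prob)
  also have "1 - cdf M x = measure M {x<..}"
    using prob_compl[of "{..x}"] by (simp add: cdf_def Compl_eq_Diff_UNIV[symmetric] flip: Compl_atMost)
  finally show "emeasure M {x<..} = emeasure (density lborel (\<lambda>x. ennreal (density_derivative 0 x))) {x<..}"
    by (simp add: emeasure_eq_measure)
qed auto

end

section \<open>Tails of the limit law\<close>

lemma sets_unit_points: "{u \<in> space (uniforms K). u \<in> unit_points K} \<in> sets (uniforms K)"
proof -
  have [measurable]: "(\<lambda>u. u i) \<in> borel_measurable (uniforms K)" if "i \<in> {1..K}" for i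
    using that by (rule measurable_coord_uniforms)
  have "{u \<in> space (uniforms K). \<forall>i\<in>{1..K}. u i \<in> {0..1}} \<in> sets (uniforms K)"
    by measurable
  then show ?thesis by (simp add: unit_points_def)
qed

context
  fixes K :: nat and \<mu> :: "real measure"
  assumes K: "K \<ge> 1" and law: "quicksort_limit_law K \<mu>"
begin

interpretation M: real_distribution \<mu> by (rule real_distribution_law[OF K law])

interpretation U: prob_space "uniforms K" by (rule prob_space_uniforms)

abbreviation Zs :: "(nat \<Rightarrow> real) measure" where "Zs \<equiv> \<Pi>\<^sub>M i\<in>{0..K}. \<mu>"

interpretation Z: prob_space Zs
  by (intro prob_space_PiM M.prob_space_axioms)

interpretation ZU: pair_prob_space Zs "uniforms K" ..

definition tail :: "real \<Rightarrow> real" where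
  "tail y = measure \<mu> {z. y < \<bar>z\<bar>}"

lemma tail_nonneg: "0 \<le> tail y" and tail_le_1: "tail y \<le> 1"
  by (auto simp: tail_def)

lemma measurable_coord_Zs: "i \<le> K \<Longrightarrow> (\<lambda>z. z i) \<in> borel_measurable Zs"
  using measurable_component_singleton[of i "{0..K}" "\<lambda>_. \<mu>"]
    measurable_cong_sets[OF refl sets_law[OF K law]] by auto

lemma prob_coord_Zs:
  assumes "i \<le> K" "A \<in> sets borel"
  shows "measure Zs {z \<in> space Zs. z i \<in> A} = measure \<mu> A"
proof -
  have "distr Zs \<mu> (\<lambda>z. z i) = \<mu>"
    using assms by (intro distr_PiM_component M.prob_space_axioms) auto
  then have "measure \<mu> A = measure (distr Zs \<mu> (\<lambda>z. z i)) A" by simp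
  also have "\<dots> = measure Zs {z \<in> space Zs. z i \<in> A}"
    using assms measurable_component_singleton[of i "{0..K}" "\<lambda>_. \<mu>"]
    by (subst measure_distr) (auto simp: vimage_def Int_def conj_commute)
  finally show ?thesis ..
qed

lemma prob_two_coords_Zs:
  assumes "i \<le> K" "j \<le> K" "i \<noteq> j"
  shows "measure Zs {z \<in> space Zs. y < \<bar>z i\<bar> \<and> y < \<bar>z j\<bar>} = (tail y)\<^sup>2"
proof -
  interpret PS: product_sigma_finite "\<lambda>_::nat. \<mu>"
    by (simp add: product_sigma_finite_def M.sigma_finite_measure_axioms)
  define A where "A k = (if k \<in> {i, j} then {z::real. y < \<bar>z\<bar>} else UNIV)" for k
  have A: "A k \<in> sets \<mu>" for k by (auto simp: A_def)
  have "{z \<in> space Zs. y < \<bar>z i\<bar> \<and> y < \<bar>z j\<bar>} = Pi\<^sub>E {0..K} A"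
    using assms by (auto simp: A_def space_PiM PiE_def Pi_def)
  then have "emeasure Zs {z \<in> space Zs. y < \<bar>z i\<bar> \<and> y < \<bar>z j\<bar>} = (\<Prod>k\<in>{0..K}. emeasure \<mu> (A k))"
    using A by (simp add: PS.emeasure_PiM)
  also have "\<dots> = ennreal (\<Prod>k\<in>{0..K}. measure \<mu> (A k))"
    by (simp add: M.emeasure_eq_measure prod_ennreal)
  also have "(\<Prod>k\<in>{0..K}. measure \<mu> (A k)) = (\<Prod>k\<in>{i, j}. measure \<mu> (A k))"
    using assms M.prob_space by (intro prod.mono_neutral_right) (auto simp: A_def)
  also have "\<dots> = (tail y)\<^sup>2" using assms by (simp add: A_def tail_def power2_eq_square)
  finally show ?thesis by (simp add: measure_def)
qed

text \<open>The sum of two powers in the hypothesis is the shape of the induction hypothesis in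
  \<open>tail_doubling\<close>.\<close>

lemma prob_scaled_coord_le:
  assumes "i \<le> K" "0 \<le> d" "0 < y" "0 \<le> a" "0 \<le> b"
    and T: "\<And>v. v > 0 \<Longrightarrow> tail v \<le> a / v ^ p + b / v ^ q"
  shows "measure Zs {z \<in> space Zs. y < d * \<bar>z i\<bar>} \<le> a * d ^ p / y ^ p + b * d ^ q / y ^ q"
proof (cases "d = 0")
  case True
  then have "{z \<in> space Zs. y < d * \<bar>z i\<bar>} = {}" using assms by auto
  then have "measure Zs {z \<in> space Zs. y < d * \<bar>z i\<bar>} = 0" by (simp only: measure_empty)
  moreover have "0 \<le> a * d ^ p / y ^ p + b * d ^ q / y ^ q"
    using assms(2-5) by (intro add_nonneg_nonneg divide_nonneg_nonneg mult_nonneg_nonneg) auto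
  ultimately show ?thesis by simp
next
  case False
  then have d: "d > 0" using assms by simp
  have "{z \<in> space Zs. y < d * \<bar>z i\<bar>} = {z \<in> space Zs. z i \<in> {x. y / d < \<bar>x\<bar>}}"
    using d by (auto simp: field_simps)
  then have "measure Zs {z \<in> space Zs. y < d * \<bar>z i\<bar>} = tail (y / d)"
    using prob_coord_Zs[OF assms(1), of "{x. y / d < \<bar>x\<bar>}"] by (simp add: tail_def)
  also have "\<dots> \<le> a / (y / d) ^ p + b / (y / d) ^ q" using assms d by (intro T) auto
  finally show ?thesis using d by (simp add: power_divide)
qed

lemma sets_scaled_coord:
  assumes "i \<le> K"
  shows "{p \<in> space (Zs \<Otimes>\<^sub>M uniforms K). y < spacing K (snd p) i * \<bar>fst p i\<bar>} \<in> sets (Zs \<Otimes>\<^sub>M uniforms K)"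
proof -
  have "(\<lambda>p. spacing K (snd p) i * \<bar>fst p i\<bar>) \<in> borel_measurable (Zs \<Otimes>\<^sub>M uniforms K)"
    by (intro borel_measurable_times borel_measurable_abs
        measurable_compose[OF measurable_snd measurable_spacing[OF K]]
        measurable_compose[OF measurable_fst measurable_coord_Zs[OF assms]])
  from borel_measurable_less[OF borel_measurable_const this] show ?thesis .
qed

text \<open>Conditioning on the pivots makes the spacing a constant factor; averaging then turns its
  powers into the moments that contract.\<close>

lemma prob_scaled_spacing_le:
  assumes i: "i \<le> K" and "0 < y" "0 \<le> a" "0 \<le> b"
    and T: "\<And>v. v > 0 \<Longrightarrow> tail v \<le> a / v ^ p + b / v ^ q"
  shows "measure (Zs \<Otimes>\<^sub>M uniforms K) {w \<in> space (Zs \<Otimes>\<^sub>M uniforms K). y < spacing K (snd w) i * \<bar>fst w i\<bar>}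
    \<le> a / y ^ p * (\<integral>u. spacing K u i ^ p \<partial>uniforms K) + b / y ^ q * (\<integral>u. spacing K u i ^ q \<partial>uniforms K)"
    (is "measure ?P ?S \<le> ?R")
proof -
  let ?f = "\<lambda>u. a / y ^ p * spacing K u i ^ p + b / y ^ q * spacing K u i ^ q"
  have "emeasure ?P ?S = (\<integral>\<^sup>+u. emeasure Zs ((\<lambda>z. (z, u)) -` ?S) \<partial>uniforms K)"
    by (rule ZU.emeasure_pair_measure_alt2[OF sets_scaled_coord[OF i]])
  also have "\<dots> \<le> (\<integral>\<^sup>+u. ennreal (?f u) \<partial>uniforms K)"
  proof (rule nn_integral_mono_AE)
    show "AE u in uniforms K. emeasure Zs ((\<lambda>z. (z, u)) -` ?S) \<le> ennreal (?f u)"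
      using AE_unit_points AE_space
    proof eventually_elim
      case (elim u)
      have "(\<lambda>z. (z, u)) -` ?S = {z \<in> space Zs. y < spacing K u i * \<bar>z i\<bar>}"
        using elim by (auto simp: space_pair_measure)
      moreover have "measure Zs {z \<in> space Zs. y < spacing K u i * \<bar>z i\<bar>}
          \<le> a * spacing K u i ^ p / y ^ p + b * spacing K u i ^ q / y ^ q"
        using elim i assms by (intro prob_scaled_coord_le T spacing_nonneg[OF K])
      ultimately show ?case
        unfolding Z.emeasure_eq_measure by (intro ennreal_leI) simp
    qed
  qed
  also have "\<dots> = ennreal (\<integral>u. ?f u \<partial>uniforms K)"
  proof (rule nn_integral_eq_integral)
    show "integrable (uniforms K) ?f"
      using i by (intro Bochner_Integration.integrable_add integrable_mult_right integrable_spacing_power[OF K])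
    show "AE u in uniforms K. 0 \<le> ?f u"
      using AE_unit_points by eventually_elim (use i assms spacing_nonneg[OF K] in simp)
  qed
  also have "(\<integral>u. ?f u \<partial>uniforms K) = ?R"
    using i integrable_spacing_power[OF K] by (subst Bochner_Integration.integral_add) auto
  finally have "ennreal (measure ?P ?S) \<le> ennreal ?R"
    unfolding ZU.P.emeasure_eq_measure .
  moreover have "0 \<le> ?R"
    using assms spacing_nonneg[OF K]
    by (intro add_nonneg_nonneg mult_nonneg_nonneg integral_nonneg_AE)
      (auto intro!: eventually_mono[OF AE_unit_points])
  ultimately show ?thesis by simp
qed

lemma AE_unit_points_snd: "AE w in Zs \<Otimes>\<^sub>M uniforms K. snd w \<in> unit_points K"
proof (rule ZU.AE_pair_measure)
  have "{w \<in> space (Zs \<Otimes>\<^sub>M uniforms K). snd w \<in> unit_points K} =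
      space Zs \<times> {u \<in> space (uniforms K). u \<in> unit_points K}"
    by (auto simp: space_pair_measure)
  then show "{w \<in> space (Zs \<Otimes>\<^sub>M uniforms K). snd w \<in> unit_points K} \<in> sets (Zs \<Otimes>\<^sub>M uniforms K)"
    using sets_unit_points by simp
  show "AE z in Zs. AE u in uniforms K. snd (z, u) \<in> unit_points K"
    using AE_unit_points by simp
qed

definition toll_bound :: real where
  "toll_bound = (real K + 1) * \<alpha> K + real K"

lemma toll_bound_pos: "0 < toll_bound"
  using K \<alpha>_pos[OF K] unfolding toll_bound_def by (intro add_pos_pos mult_pos_pos) auto

text \<open>If at most one copy exceeds e * y, the others contribute at most e * y because the
  spacings sum to 1, and the toll at most another e * y. The remaining term must carry (1 - 2 * e) *
  y.\<close>

lemma large_recursion_value: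
  assumes u: "u \<in> unit_points K" and y: "y < \<bar>recursion_value K z u\<bar>" "0 < y"
    and e: "toll_bound \<le> e * y" "0 < e"
  shows "(\<exists>i\<le>K. \<exists>j\<le>K. i \<noteq> j \<and> e * y < \<bar>z i\<bar> \<and> e * y < \<bar>z j\<bar>) \<or>
    (\<exists>i\<le>K. (1 - 2 * e) * y < spacing K u i * \<bar>z i\<bar>)"
proof (rule disjCI)
  assume small: "\<not> (\<exists>i\<le>K. (1 - 2 * e) * y < spacing K u i * \<bar>z i\<bar>)"
  show "\<exists>i\<le>K. \<exists>j\<le>K. i \<noteq> j \<and> e * y < \<bar>z i\<bar> \<and> e * y < \<bar>z j\<bar>"
  proof (rule ccontr)
    assume no: "\<not> ?thesis"
    obtain i where i: "i \<le> K" "\<And>j. j \<le> K \<Longrightarrow> j \<noteq> i \<Longrightarrow> \<bar>z j\<bar> \<le> e * y"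
    proof (cases "\<exists>i\<le>K. e * y < \<bar>z i\<bar>")
      case True
      then obtain i where "i \<le> K" "e * y < \<bar>z i\<bar>" by blast
      then show ?thesis using no that[of i] by force
    next
      case False
      then show ?thesis using that[of 0] by force
    qed
    have D: "0 \<le> spacing K u j" if "j \<le> K" for j using spacing_nonneg[OF K u that] .
    have "\<bar>\<Sum>j=0..K. spacing K u j * z j\<bar> \<le> (\<Sum>j=0..K. \<bar>spacing K u j * z j\<bar>)" by (rule sum_abs)
    also have "\<dots> = spacing K u i * \<bar>z i\<bar> + (\<Sum>j\<in>{0..K} - {i}. spacing K u j * \<bar>z j\<bar>)"
      using i(1) D by (subst sum.remove[of _ i]) (auto simp: abs_mult)
    also have "(\<Sum>j\<in>{0..K} - {i}. spacing K u j * \<bar>z j\<bar>) \<le> (\<Sum>j\<in>{0..K} - {i}. spacing K u j * (e * y))"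
      using i D by (intro sum_mono mult_left_mono) auto
    also have "\<dots> \<le> (\<Sum>j\<in>{0..K}. spacing K u j * (e * y))"
      using D e y by (intro sum_mono2) auto
    also have "\<dots> = e * y" using sum_spacing[OF K] by (simp flip: sum_distrib_right)
    finally have "\<bar>\<Sum>j=0..K. spacing K u j * z j\<bar> \<le> spacing K u i * \<bar>z i\<bar> + e * y" by simp
    moreover have "\<bar>toll K u\<bar> \<le> e * y"
      using abs_toll_le[OF K u] e by (simp add: toll_bound_def)
    moreover have "spacing K u i * \<bar>z i\<bar> \<le> y - e * y - e * y"
      using small i(1) by (auto simp: algebra_simps not_less)
    ultimately show False using y unfolding recursion_value_def by linarith
  qed
qed

text \<open>Union bound over the two alternatives. There are at most (K + 1)^2 ordered pairs of
  distinct copies, and independence gives each pair the squared tail.\<close>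

lemma tail_recursion:
  assumes "0 < y" "0 < e" "toll_bound \<le> e * y"
  shows "tail y \<le> (real K + 1)\<^sup>2 * (tail (e * y))\<^sup>2 +
    (\<Sum>i=0..K. measure (Zs \<Otimes>\<^sub>M uniforms K)
      {w \<in> space (Zs \<Otimes>\<^sub>M uniforms K). (1 - 2 * e) * y < spacing K (snd w) i * \<bar>fst w i\<bar>})"
proof -
  let ?P = "Zs \<Otimes>\<^sub>M uniforms K"
  define R where "R = (\<lambda>(i, j). {z \<in> space Zs. e * y < \<bar>z i\<bar> \<and> e * y < \<bar>z j\<bar>} \<times> space (uniforms K))"
  define S where "S i = {w \<in> space ?P. (1 - 2 * e) * y < spacing K (snd w) i * \<bar>fst w i\<bar>}" for i
  define I where "I = {(i, j). i \<le> K \<and> j \<le> K \<and> i \<noteq> j}"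
  have I: "I \<subseteq> {0..K} \<times> {0..K}" by (auto simp: I_def)
  then have finI: "finite I" by (rule finite_subset) simp
  have cardI: "real (card I) \<le> (real K + 1)\<^sup>2"
  proof -
    have "card I \<le> card ({0..K} \<times> {0..K})" by (rule card_mono[OF _ I]) simp
    then have "real (card I) \<le> real ((K + 1) * (K + 1))" unfolding of_nat_le_iff by simp
    then show ?thesis by (simp add: power2_eq_square algebra_simps)
  qed
  have Rsets0: "{z \<in> space Zs. e * y < \<bar>z i\<bar> \<and> e * y < \<bar>z j\<bar>} \<in> sets Zs" if "i \<le> K" "j \<le> K" for i j
    using measurable_coord_Zs[OF that(1)] measurable_coord_Zs[OF that(2)] by measurable
  have R: "R k \<in> sets ?P" "measure ?P (R k) = (tail (e * y))\<^sup>2" if k: "k \<in> I" for k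
  proof -
    obtain i j where ij: "k = (i, j)" "i \<le> K" "j \<le> K" "i \<noteq> j" using k by (auto simp: I_def)
    note s = Rsets0[OF ij(2,3)]
    show "R k \<in> sets ?P" using s by (simp add: R_def ij)
    have "emeasure ?P (R k) = emeasure Zs {z \<in> space Zs. e * y < \<bar>z i\<bar> \<and> e * y < \<bar>z j\<bar>} * emeasure (uniforms K) (space (uniforms K))"
      unfolding R_def ij prod.case by (rule U.emeasure_pair_measure_Times[OF s]) simp
    then show "measure ?P (R k) = (tail (e * y))\<^sup>2"
      using prob_two_coords_Zs[OF ij(2,3,4), of "e * y"] by (simp add: U.emeasure_space_1 measure_def)
  qed
  have S: "S i \<in> sets ?P" if "i \<in> {0..K}" for i
    unfolding S_def using that by (intro sets_scaled_coord) simp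
  have "tail y = measure ?P {w \<in> space ?P. y < \<bar>case w of (z, u) \<Rightarrow> recursion_value K z u\<bar>}"
  proof -
    have "tail y = measure (distr ?P borel (\<lambda>(z, u). recursion_value K z u)) {z. y < \<bar>z\<bar>}"
      unfolding tail_def by (subst law_eq[OF K law]) (rule refl)
    also have "\<dots> = measure ?P ((\<lambda>(z, u). recursion_value K z u) -` {z. y < \<bar>z\<bar>} \<inter> space ?P)"
      using measurable_recursion_value[OF K sets_law[OF K law]] by (rule measure_distr) simp
    finally show ?thesis by (simp add: vimage_def Int_def conj_commute)
  qed
  also have "\<dots> \<le> measure ?P ((\<Union>k\<in>I. R k) \<union> (\<Union>i\<in>{0..K}. S i))"
  proof (rule ZU.P.finite_measure_mono_AE)
    show "AE w in ?P. w \<in> {w \<in> space ?P. y < \<bar>case w of (z, u) \<Rightarrow> recursion_value K z u\<bar>} \<longrightarrow>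
        w \<in> (\<Union>k\<in>I. R k) \<union> (\<Union>i\<in>{0..K}. S i)"
      using AE_unit_points_snd
    proof eventually_elim
      case (elim w)
      show ?case
      proof
        assume w: "w \<in> {w \<in> space ?P. y < \<bar>case w of (z, u) \<Rightarrow> recursion_value K z u\<bar>}"
        obtain z u where zu: "w = (z, u)" by (cases w)
        have sp: "z \<in> space Zs" "u \<in> space (uniforms K)" using w by (auto simp: zu space_pair_measure)
        have "(\<exists>i\<le>K. \<exists>j\<le>K. i \<noteq> j \<and> e * y < \<bar>z i\<bar> \<and> e * y < \<bar>z j\<bar>) \<or>
            (\<exists>i\<le>K. (1 - 2 * e) * y < spacing K u i * \<bar>z i\<bar>)"
          using w elim assms by (intro large_recursion_value) (auto simp: zu)
        then show "w \<in> (\<Union>k\<in>I. R k) \<union> (\<Union>i\<in>{0..K}. S i)"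
        proof
          assume "\<exists>i\<le>K. \<exists>j\<le>K. i \<noteq> j \<and> e * y < \<bar>z i\<bar> \<and> e * y < \<bar>z j\<bar>"
          then obtain i j where "i \<le> K" "j \<le> K" "i \<noteq> j" "e * y < \<bar>z i\<bar>" "e * y < \<bar>z j\<bar>" by blast
          then have "(i, j) \<in> I" "w \<in> R (i, j)" using sp by (auto simp: I_def R_def zu)
          then show ?thesis by blast
        next
          assume "\<exists>i\<le>K. (1 - 2 * e) * y < spacing K u i * \<bar>z i\<bar>"
          then obtain i where "i \<le> K" "(1 - 2 * e) * y < spacing K u i * \<bar>z i\<bar>" by blast
          then have "i \<in> {0..K}" "w \<in> S i" using w by (auto simp: S_def zu)
          then show ?thesis by blast
        qed
      qed
    qed
    show "(\<Union>k\<in>I. R k) \<union> (\<Union>i\<in>{0..K}. S i) \<in> sets ?P"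
      using R S finI by (intro sets.Un sets.finite_UN) auto
  qed
  also have "\<dots> \<le> measure ?P (\<Union>k\<in>I. R k) + measure ?P (\<Union>i\<in>{0..K}. S i)"
    using R S finI by (intro measure_Un_le sets.finite_UN) auto
  also have "\<dots> \<le> (\<Sum>k\<in>I. measure ?P (R k)) + (\<Sum>i\<in>{0..K}. measure ?P (S i))"
    using R S finI by (intro add_mono ZU.P.finite_measure_subadditive_finite) auto
  also have "(\<Sum>k\<in>I. measure ?P (R k)) = real (card I) * (tail (e * y))\<^sup>2"
    using R(2) by simp
  also have "\<dots> \<le> (real K + 1)\<^sup>2 * (tail (e * y))\<^sup>2"
    using cardI by (intro mult_right_mono) auto
  finally show ?thesis by (simp add: S_def)
qed

text \<open>Two large copies contribute the square of a tail, which doubles the exponent; a single large copy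
  is damped by its spacing, and iterating this contraction removes the original exponent.\<close>

lemma tail_doubling:
  assumes q: "q \<ge> 2" and C: "\<And>y. y > 0 \<Longrightarrow> tail y \<le> C / y ^ q"
  shows "\<exists>A. \<forall>y>0. tail y \<le> A / y ^ (2 * q)"
proof -
  have C0: "0 \<le> C" using order_trans[OF tail_nonneg C[of 1]] by simp
  obtain s where s: "0 < s" "s < 1"
    and sum_le: "\<And>q. q \<ge> 2 \<Longrightarrow> (\<Sum>i=0..K. \<integral>u. spacing K u i ^ q \<partial>uniforms K) \<le> s"
    using expectation_sum_spacing_power[OF K] by auto
  \<comment> \<open>Only the fraction c = 1 - 2 * e of \<open>y\<close> is left to the single large
    copy, at the cost of a factor 1 / c ^ (2 * q). With c ^ (2 * q) halfway between \<open>s\<close>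
    and 1, the contraction by \<open>s\<close> still wins: r < 1.\<close>
  define c where "c = root (2 * q) ((1 + s) / 2)"
  have cpow: "c ^ (2 * q) = (1 + s) / 2" unfolding c_def using q s by (intro real_root_pow_pos2) auto
  have c: "0 < c" "c < 1" unfolding c_def using q s by auto
  define e where "e = (1 - c) / 2"
  have e: "0 < e" "1 - 2 * e = c" using c by (simp_all add: e_def diff_divide_distrib)
  define r where "r = s / c ^ (2 * q)"
  have r: "0 < r" "r < 1" unfolding r_def cpow using s by (auto simp: field_simps)
  have sq: "s / c ^ q \<le> r"
    unfolding r_def using c s q by (intro divide_left_mono power_decreasing) auto
  define A0 where "A0 = (real K + 1)\<^sup>2 * (C / e ^ q)\<^sup>2"
  \<comment> \<open>The first entry gives A0 + A * r \<le> A, which closes the induction; the second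
    makes the bound at least 1 for all \<open>y\<close> too small to dominate the toll.\<close>
  define A where "A = max (A0 / (1 - r)) ((toll_bound / e) ^ (2 * q))"
  have "0 \<le> (toll_bound / e) ^ (2 * q)" using toll_bound_pos e by simp
  then have A: "0 \<le> A" "A0 \<le> A * (1 - r)" "(toll_bound / e) ^ (2 * q) \<le> A"
    using r by (auto simp: A_def pos_divide_le_eq[symmetric] max.coboundedI2)
  \<comment> \<open>Each application of the recursion multiplies the term of the old exponent by
    \<open>r\<close>, while the term of the doubled exponent reproduces itself; n then tends to
    infinity.\<close>
  have main: "tail y \<le> A / y ^ (2 * q) + C * r ^ n / y ^ q" if "y > 0" for y n
    using that
  proof (induction n arbitrary: y)
    case 0
    then show ?case using C[OF 0] A by (simp add: add_increasing)
  next
    case (Suc n)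
    show ?case
    proof (cases "toll_bound \<le> e * y")
      case False
      then have "y \<le> toll_bound / e" using e by (simp add: field_simps)
      then have "y ^ (2 * q) \<le> A"
        using Suc.prems A power_mono[of y "toll_bound / e" "2 * q"] by linarith
      then have "1 \<le> A / y ^ (2 * q)" using Suc.prems by simp
      moreover have "0 \<le> C * r ^ Suc n / y ^ q" using C0 r Suc.prems by simp
      ultimately show ?thesis using tail_le_1[of y] by linarith
    next
      case True
      let ?E = "\<lambda>q i. \<integral>u. spacing K u i ^ q \<partial>uniforms K"
      have "tail (e * y) \<le> C / (e * y) ^ q" using e Suc.prems by (intro C) simp
      then have "(tail (e * y))\<^sup>2 \<le> (C / (e * y) ^ q)\<^sup>2"
        by (intro power_mono tail_nonneg)
      then have "(real K + 1)\<^sup>2 * (tail (e * y))\<^sup>2 \<le> (real K + 1)\<^sup>2 * (C / (e * y) ^ q)\<^sup>2"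
        by (intro mult_left_mono) auto
      also have "\<dots> = A0 / y ^ (2 * q)"
        by (simp add: A0_def power_divide power_mult_distrib mult.commute[of 2 q] flip: power_mult)
      finally have pairs: "(real K + 1)\<^sup>2 * (tail (e * y))\<^sup>2 \<le> A0 / y ^ (2 * q)" .
      have "(\<Sum>i=0..K. measure (Zs \<Otimes>\<^sub>M uniforms K)
          {w \<in> space (Zs \<Otimes>\<^sub>M uniforms K). (1 - 2 * e) * y < spacing K (snd w) i * \<bar>fst w i\<bar>})
        \<le> (\<Sum>i=0..K. A / (c * y) ^ (2 * q) * ?E (2 * q) i + C * r ^ n / (c * y) ^ q * ?E q i)"
        unfolding e(2) using c Suc.prems A C0 r
        by (intro sum_mono prob_scaled_spacing_le Suc.IH) auto
      also have "\<dots> = A / (c * y) ^ (2 * q) * (\<Sum>i=0..K. ?E (2 * q) i) + C * r ^ n / (c * y) ^ q * (\<Sum>i=0..K. ?E q i)"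
        by (simp only: sum.distrib sum_distrib_left)
      also have "\<dots> \<le> A / (c * y) ^ (2 * q) * s + C * r ^ n / (c * y) ^ q * s"
        using c Suc.prems A C0 r q by (intro add_mono mult_left_mono sum_le) auto
      also have "\<dots> = A * r / y ^ (2 * q) + C * r ^ n * (s / c ^ q) / y ^ q"
        by (simp add: r_def power_mult_distrib)
      also have "\<dots> \<le> A * r / y ^ (2 * q) + C * r ^ n * r / y ^ q"
        using sq C0 r Suc.prems by (intro add_mono order_refl divide_right_mono mult_left_mono) auto
      finally have "tail y \<le> A0 / y ^ (2 * q) + (A * r / y ^ (2 * q) + C * r ^ n * r / y ^ q)"
        using tail_recursion[OF Suc.prems e(1) True] pairs by linarith
      moreover have "A0 / y ^ (2 * q) \<le> A * (1 - r) / y ^ (2 * q)"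
        using A Suc.prems by (intro divide_right_mono) auto
      moreover have "A * (1 - r) / y ^ (2 * q) + A * r / y ^ (2 * q) = A / y ^ (2 * q)"
        by (simp add: algebra_simps flip: add_divide_distrib)
      moreover have eq: "C * r ^ Suc n / y ^ q = C * r ^ n * r / y ^ q" by simp
      ultimately show ?thesis unfolding eq by linarith
    qed
  qed
  have "tail y \<le> A / y ^ (2 * q)" if y: "y > 0" for y
  proof (rule LIMSEQ_le_const)
    have "(\<lambda>n. A / y ^ (2 * q) + C * r ^ n / y ^ q) \<longlonglongrightarrow> A / y ^ (2 * q) + C * 0 / y ^ q"
      using r y by (intro tendsto_intros LIMSEQ_realpow_zero) auto
    then show "(\<lambda>n. A / y ^ (2 * q) + C * r ^ n / y ^ q) \<longlonglongrightarrow> A / y ^ (2 * q)" by simp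
    show "\<exists>N. \<forall>n\<ge>N. tail y \<le> A / y ^ (2 * q) + C * r ^ n / y ^ q" using main[OF y] by blast
  qed
  then show ?thesis by blast
qed

lemma tail_square: "\<exists>C. \<forall>y>0. tail y \<le> C / y ^ 2"
proof -
  have int: "integrable \<mu> (\<lambda>x. x\<^sup>2)" using law by (simp add: quicksort_limit_law_def)
  have "tail y \<le> (\<integral>x. x\<^sup>2 \<partial>\<mu>) / y ^ 2" if "y > 0" for y
  proof -
    have "tail y \<le> measure \<mu> {x \<in> space \<mu>. x\<^sup>2 \<ge> y ^ 2}"
      unfolding tail_def using that
      by (intro M.finite_measure_mono) (auto simp: abs_le_square_iff[symmetric])
    also have "\<dots> \<le> (\<integral>x. x\<^sup>2 \<partial>\<mu>) / y ^ 2"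
      using that int by (intro integral_Markov_inequality_measure[where A = "{}"]) auto
    finally show ?thesis .
  qed
  then show ?thesis by blast
qed

lemma tail_polynomial: "\<exists>C. \<forall>y\<ge>1. y ^ n * tail y \<le> C"
proof -
  have "\<exists>C. \<forall>y>0. tail y \<le> C / y ^ (2 ^ Suc m)" for m
  proof (induction m)
    case 0
    show ?case using tail_square by simp
  next
    case (Suc m)
    have "(2::nat) \<le> 2 ^ Suc m" by simp
    with Suc tail_doubling[of "2 ^ Suc m"] show ?case by auto
  qed
  then obtain C where C: "\<And>y. y > 0 \<Longrightarrow> tail y \<le> C / y ^ (2 ^ Suc n)" by blast
  have "y ^ n * tail y \<le> C" if "y \<ge> 1" for y
  proof -
    have "n \<le> 2 ^ Suc n" using less_exp[of "Suc n"] by linarith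
    then have "y ^ n * tail y \<le> y ^ (2 ^ Suc n) * tail y"
      using that tail_nonneg by (intro mult_right_mono power_increasing) auto
    also have "\<dots> \<le> C" using C[of y] that by (simp add: field_simps)
    finally show ?thesis .
  qed
  then show ?thesis by blast
qed

end

section \<open>Smoothness and rapid decrease\<close>

text \<open>The mean value theorem yields the difference quotient as a value of \<open>f'\<close>
  nearby; a second application moves it to \<open>x\<close> at cost B * h.\<close>

lemma derivative_bound_by_increment:
  fixes f f' f'' :: "real \<Rightarrow> real"
  assumes d1: "\<And>x. (f has_real_derivative f' x) (at x)"
    and d2: "\<And>x. (f' has_real_derivative f'' x) (at x)"
    and B: "\<And>x. \<bar>f'' x\<bar> \<le> B" and h: "h > 0"
  shows "\<bar>f' x\<bar> \<le> \<bar>f (x + h) - f x\<bar> / h + B * h"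
proof -
  obtain z where z: "x < z" "z < x + h" "f (x + h) - f x = (x + h - x) * f' z"
    using MVT2[of x "x + h" f f'] h d1 by auto
  obtain w where w: "f' z - f' x = (z - x) * f'' w"
    using MVT2[of x z f' f''] z d2 by auto
  have "\<bar>f' z - f' x\<bar> \<le> h * B"
    unfolding w abs_mult using z B[of w] by (intro mult_mono) auto
  moreover have "\<bar>f (x + h) - f x\<bar> / h = \<bar>f' z\<bar>" using z(3) h by (simp add: abs_mult)
  ultimately show ?thesis by (simp add: mult.commute)
qed

text \<open>The distribution function tends to 1 at the right end, so only its increments can be
  small. This notion covers it together with decaying functions; 2 \<le> \<bar>x\<bar> keeps x + h
  away from the origin.\<close>

definition polynomially_small_increments :: "(real \<Rightarrow> real) \<Rightarrow> bool" where
  "polynomially_small_increments f \<longleftrightarrow>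
     (\<forall>n. \<exists>C. \<forall>x h. 2 \<le> \<bar>x\<bar> \<longrightarrow> 0 < h \<longrightarrow> h \<le> 1 \<longrightarrow> \<bar>x\<bar> ^ n * \<bar>f (x + h) - f x\<bar> \<le> C)"

text \<open>With a step \<open>h = \<bar>x\<bar> ^ (- n)\<close>, a bound \<open>\<bar>x\<bar> ^ (- 2 n)\<close> on the increments of \<open>f\<close> and a bounded second
  derivative give \<open>f' x = O(\<bar>x\<bar> ^ (- n))\<close>.\<close>

lemma derivative_polynomially_small:
  fixes f f' f'' :: "real \<Rightarrow> real"
  assumes d1: "\<And>x. (f has_real_derivative f' x) (at x)"
    and d2: "\<And>x. (f' has_real_derivative f'' x) (at x)"
    and B: "\<And>x. \<bar>f'' x\<bar> \<le> B" and B1: "\<And>x. \<bar>f' x\<bar> \<le> B1"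
    and inc: "polynomially_small_increments f"
  shows "\<exists>C. \<forall>x. \<bar>x\<bar> ^ n * \<bar>f' x\<bar> \<le> C"
proof -
  obtain C where C: "\<And>x h. 2 \<le> \<bar>x\<bar> \<Longrightarrow> 0 < h \<Longrightarrow> h \<le> 1 \<Longrightarrow> \<bar>x\<bar> ^ (2 * n) * \<bar>f (x + h) - f x\<bar> \<le> C"
    using inc unfolding polynomially_small_increments_def by blast
  \<comment> \<open>The first entry of the maximum covers \<bar>x\<bar> < 2, the second the region
    where the increments are controlled.\<close>
  have "\<bar>x\<bar> ^ n * \<bar>f' x\<bar> \<le> max (2 ^ n * B1) (C + B)" for x
  proof (cases "2 \<le> \<bar>x\<bar>")
    case True
    define h where "h = 1 / \<bar>x\<bar> ^ n"
    have p: "1 \<le> \<bar>x\<bar> ^ n" using True by (intro one_le_power) auto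
    then have h: "0 < h" "h \<le> 1" "\<bar>x\<bar> ^ n * h = 1" unfolding h_def using True by auto
    have "\<bar>x\<bar> ^ n * \<bar>f' x\<bar> \<le> \<bar>x\<bar> ^ n * (\<bar>f (x + h) - f x\<bar> / h + B * h)"
      using h by (intro mult_left_mono derivative_bound_by_increment[OF d1 d2 B]) auto
    also have "\<dots> = \<bar>x\<bar> ^ (2 * n) * \<bar>f (x + h) - f x\<bar> + B * (\<bar>x\<bar> ^ n * h)"
      by (simp add: h_def distrib_left power_mult power2_eq_square mult.commute[of 2 n] power_mult_distrib)
    also have "\<dots> \<le> C + B" using C[OF True h(1,2)] h(3) by simp
    finally show ?thesis by simp
  next
    case False
    then have "\<bar>x\<bar> ^ n * \<bar>f' x\<bar> \<le> 2 ^ n * B1" using B1 by (intro mult_mono power_mono) auto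
    then show ?thesis by simp
  qed
  then show ?thesis by blast
qed

lemma polynomially_small_increments_of_decay:
  fixes f :: "real \<Rightarrow> real"
  assumes "\<And>n. \<exists>C. \<forall>x. \<bar>x\<bar> ^ n * \<bar>f x\<bar> \<le> C"
  shows "polynomially_small_increments f"
  unfolding polynomially_small_increments_def
proof
  fix n
  obtain C where C: "\<And>x. \<bar>x\<bar> ^ n * \<bar>f x\<bar> \<le> C" using assms by blast
  have "\<bar>x\<bar> ^ n * \<bar>f (x + h) - f x\<bar> \<le> 2 ^ n * C + C" if "2 \<le> \<bar>x\<bar>" "0 < h" "h \<le> 1" for x h
  proof -
    have "\<bar>x\<bar> \<le> 2 * \<bar>x + h\<bar>" using that abs_triangle_ineq[of "x + h" "- h"] by simp
    then have "\<bar>x\<bar> ^ n \<le> (2 * \<bar>x + h\<bar>) ^ n" by (intro power_mono) auto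
    then have "\<bar>x\<bar> ^ n * \<bar>f (x + h)\<bar> \<le> 2 ^ n * (\<bar>x + h\<bar> ^ n * \<bar>f (x + h)\<bar>)"
      using mult_right_mono[of "\<bar>x\<bar> ^ n" "(2 * \<bar>x + h\<bar>) ^ n" "\<bar>f (x + h)\<bar>"]
      by (simp add: power_mult_distrib mult.assoc)
    also have "\<dots> \<le> 2 ^ n * C" using C by (intro mult_left_mono) auto
    finally have "\<bar>x\<bar> ^ n * \<bar>f (x + h)\<bar> \<le> 2 ^ n * C" .
    moreover have "\<bar>x\<bar> ^ n * \<bar>f (x + h) - f x\<bar> \<le> \<bar>x\<bar> ^ n * (\<bar>f (x + h)\<bar> + \<bar>f x\<bar>)"
      by (intro mult_left_mono) auto
    ultimately show ?thesis using C[of x] by (simp add: distrib_left)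
  qed
  then show "\<exists>C. \<forall>x h. 2 \<le> \<bar>x\<bar> \<longrightarrow> 0 < h \<longrightarrow> h \<le> 1 \<longrightarrow> \<bar>x\<bar> ^ n * \<bar>f (x + h) - f x\<bar> \<le> C"
    by blast
qed

lemma rapidly_decreasing_of_decay:
  fixes f :: "real \<Rightarrow> real"
  assumes "\<And>n. \<exists>C. \<forall>x. \<bar>x\<bar> ^ n * \<bar>f x\<bar> \<le> C"
  shows "rapidly_decreasing f"
  unfolding rapidly_decreasing_def
proof
  fix n
  obtain C where C: "\<And>x. \<bar>x\<bar> ^ Suc n * \<bar>f x\<bar> \<le> C" using assms by blast
  have "((\<lambda>x::real. C * norm (inverse x)) \<longlongrightarrow> C * norm (0::real)) at_infinity"
    by (intro tendsto_mult tendsto_const tendsto_norm tendsto_inverse_0)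
  then have lim: "((\<lambda>x::real. C * norm (inverse x)) \<longlongrightarrow> 0) at_infinity" by simp
  show "((\<lambda>x. \<bar>x\<bar> ^ n * \<bar>f x\<bar>) \<longlongrightarrow> 0) at_infinity"
  proof (rule Lim_null_comparison[OF _ lim])
    have "norm (\<bar>x\<bar> ^ n * \<bar>f x\<bar>) \<le> C * norm (inverse x)" if "1 \<le> norm x" for x :: real
    proof -
      have "0 < \<bar>x\<bar>" using that by simp
      then have "\<bar>x\<bar> ^ n * \<bar>f x\<bar> \<le> C / \<bar>x\<bar>"
        using C[of x] by (simp add: pos_le_divide_eq ac_simps)
      then show ?thesis by (simp add: abs_mult power_abs divide_inverse)
    qed
    then show "\<forall>\<^sub>F x in at_infinity. norm (\<bar>x\<bar> ^ n * \<bar>f x\<bar>) \<le> C * norm (inverse x)"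
      unfolding eventually_at_infinity by blast
  qed
qed

text \<open>The increment is the mass of an interval whose points all have modulus greater than
  \<bar>x\<bar> / 4, hence at most a tail.\<close>

lemma cdf_polynomially_small_increments:
  assumes K: "K \<ge> 1" and law: "quicksort_limit_law K \<mu>"
  shows "polynomially_small_increments (cdf \<mu>)"
  unfolding polynomially_small_increments_def
proof
  fix n
  interpret M: real_distribution \<mu> by (rule real_distribution_law[OF K law])
  obtain C where C: "\<And>y. y \<ge> 1 \<Longrightarrow> y ^ n * tail \<mu> y \<le> C" using tail_polynomial[OF K law] by blast
  have "\<bar>x\<bar> ^ n * \<bar>cdf \<mu> (x + h) - cdf \<mu> x\<bar> \<le> 4 ^ n * max (1 ^ n) C" if x: "2 \<le> \<bar>x\<bar>" "0 < h" "h \<le> 1" for x h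
  proof -
    have "cdf \<mu> (x + h) - cdf \<mu> x = measure \<mu> {x<..x + h}" using x by (intro M.cdf_diff_eq) simp
    then have "\<bar>cdf \<mu> (x + h) - cdf \<mu> x\<bar> = measure \<mu> {x<..x + h}" by simp
    also have "\<dots> \<le> tail \<mu> (\<bar>x\<bar> / 4)"
      unfolding tail_def[OF K law]
    proof (rule M.finite_measure_mono)
      have "\<bar>x\<bar> / 4 < \<bar>y\<bar>" if "x < y" "y \<le> x + h" for y using that x by linarith
      then show "{x<..x + h} \<subseteq> {z. \<bar>x\<bar> / 4 < \<bar>z\<bar>}" by auto
    qed simp
    finally have "\<bar>x\<bar> ^ n * \<bar>cdf \<mu> (x + h) - cdf \<mu> x\<bar> \<le> \<bar>x\<bar> ^ n * tail \<mu> (\<bar>x\<bar> / 4)"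
      by (intro mult_left_mono) auto
    also have "\<dots> = 4 ^ n * ((\<bar>x\<bar> / 4) ^ n * tail \<mu> (\<bar>x\<bar> / 4))"
      by (simp add: power_divide)
    also have "(\<bar>x\<bar> / 4) ^ n * tail \<mu> (\<bar>x\<bar> / 4) \<le> max (1 ^ n) C"
    proof (cases "\<bar>x\<bar> / 4 \<ge> 1")
      case True
      then show ?thesis using C[of "\<bar>x\<bar> / 4"] by simp
    next
      case False
      then have "(\<bar>x\<bar> / 4) ^ n * tail \<mu> (\<bar>x\<bar> / 4) \<le> 1 * 1"
        using tail_le_1[OF K law] tail_nonneg[OF K law] by (intro mult_mono power_le_one) auto
      then show ?thesis by simp
    qed
    finally show ?thesis by simp
  qed
  then show "\<exists>C. \<forall>x h. 2 \<le> \<bar>x\<bar> \<longrightarrow> 0 < h \<longrightarrow> h \<le> 1 \<longrightarrow> \<bar>x\<bar> ^ n * \<bar>cdf \<mu> (x + h) - cdf \<mu> x\<bar> \<le> C"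
    by blast
qed

theorem theorem6:
  fixes K :: nat and M :: "'w measure" and Z :: "'w \<Rightarrow> real"
  assumes "K \<ge> 1"
    and "prob_space M"
    and "Z \<in> borel_measurable M"
    and "quicksort_limit_law K (distr M borel Z)"
  shows "\<exists>f :: real \<Rightarrow> real.
           (\<forall>x. 0 \<le> f x) \<and>
           distributed M lborel Z (\<lambda>x. ennreal (f x)) \<and>
           smooth f \<and>
           (\<forall>k. rapidly_decreasing ((deriv ^^ k) f))"
proof -
  define \<mu> where "\<mu> = distr M borel Z"
  have law: "quicksort_limit_law K \<mu>" using assms(4) by (simp add: \<mu>_def)
  note rd = real_distribution_law[OF assms(1) law] and cd = char_decay[OF assms(1) law]
  define g where "g = density_derivative \<mu>"
  have der: "(g k has_real_derivative g (Suc k) x) (at x)" for k x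
    unfolding g_def by (rule DERIV_density_derivative[OF rd cd])
  have bounded: "\<bar>g k x\<bar> \<le> abs_moment \<mu> k / (2 * pi)" for k x
    unfolding g_def by (rule abs_density_derivative_le[OF rd cd])
  have derivs: "(deriv ^^ k) (g 0) = g k" for k
  proof (induction k)
    case (Suc k)
    have "deriv (g k) = g (Suc k)" using der by (intro ext DERIV_imp_deriv)
    then show ?case using Suc by simp
  qed simp
  \<comment> \<open>The distribution function is the antiderivative that starts the induction; after
    that, decay of each derivative gives the small increments needed for the next.\<close>
  have decay: "\<exists>C. \<forall>x. \<bar>x\<bar> ^ n * \<bar>g k x\<bar> \<le> C" for n k
  proof (induction k arbitrary: n)
    case 0
    show ?case
    proof (rule derivative_polynomially_small)
      show "(cdf \<mu> has_real_derivative g 0 x) (at x)" for x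
        unfolding g_def by (rule DERIV_cdf[OF rd cd])
    qed (rule der bounded cdf_polynomially_small_increments[OF assms(1) law])+
  next
    case (Suc k)
    show ?case
      by (rule derivative_polynomially_small[OF der der bounded bounded
            polynomially_small_increments_of_decay[OF Suc]])
  qed
  have "distributed M lborel Z (\<lambda>x. ennreal (g 0 x))"
    unfolding distributed_def
  proof (intro conjI)
    have "distr M lborel Z = \<mu>" unfolding \<mu>_def by (rule distr_cong) auto
    also have "\<dots> = density lborel (\<lambda>x. ennreal (g 0 x))"
      unfolding g_def by (rule law_eq_density[OF rd cd])
    finally show "distr M lborel Z = density lborel (\<lambda>x. ennreal (g 0 x))" .
    show "(\<lambda>x. ennreal (g 0 x)) \<in> borel_measurable lborel"
      unfolding g_def using measurable_density_derivative[OF rd cd] by simp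
    show "Z \<in> M \<rightarrow>\<^sub>M lborel" using assms(3) by simp
  qed
  moreover have "0 \<le> g 0 x" for x unfolding g_def by (rule density_nonneg[OF rd cd])
  moreover have "smooth (g 0)"
    unfolding smooth_def derivs using der real_differentiable_def by blast
  moreover have "rapidly_decreasing ((deriv ^^ k) (g 0))" for k
    unfolding derivs by (rule rapidly_decreasing_of_decay[OF decay])
  ultimately show ?thesis by blast
qed

end
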